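(* Let $n\geq 3$ and $k=\binom{n}{2}-t$ with $0\leq t\leq\frac13(n-1)^2$. (i) If $t$ is even, then $M(k,n)=\binom{n}{2}-\frac12 t$, and the extremal multiset of subgraphs is $\{t/2 * K_3,\ (\binom{n}{2}-3t/2) * K_2\}$. (ii) If $t$ is odd, then $M(k,n)=\binom{n}{2}-\frac12(t+1)+\frac13$, and the extremal multiset of subgraphs is $\{(t-1)/2 * K_3,\ (\binom{n}{2}-2-3(t-1)/2) * K_2,\ 1 * P_3\}$.
   Context: For a finite graph $G$, $\mathrm{Mad}(G)=\max\{2e(H)/|V(H)| : H\subseteq G,\ |V(H)|\geq 1\}$. $M(k,n)$ is the maximum of $\sum_{i=1}^k\mathrm{Mad}(G_i)$ over all partitions of $E(K_n)$ into $k$ spanning subgraphs $G_1,\dots,G_k$. The notation $\{t_1*H_1,\dots,t_s*H_s\}$ denotes the multiset with $t_i$ copies of $H_i$; the "extremal multiset of subgraphs" is the multiset of (isolated-vertex-free) graphs forming an edge decomposition of $K_n$ attaining $M(k,n)$. $P_3$ is the path with 3 vertices. *)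

theory Defs
  imports Complex_Main "HOL-Library.Multiset" "HOL-Library.Ramsey" "HOL-Library.Disjoint_Sets"
begin

datatype 'a ugraph = Graph (verts: "'a set") (edges: "'a set set")

definition finite_graph :: "'a ugraph \<Rightarrow> bool" where
  "finite_graph G \<longleftrightarrow> finite (verts G) \<and> edges G \<subseteq> nsets (verts G) 2"

definition subgraph :: "'a ugraph \<Rightarrow> 'a ugraph \<Rightarrow> bool" where
  "subgraph H G \<longleftrightarrow> finite_graph H \<and> verts H \<subseteq> verts G \<and> edges H \<subseteq> edges G"

definition spanning_subgraph :: "'a ugraph \<Rightarrow> 'a ugraph \<Rightarrow> bool" where
  "spanning_subgraph H G \<longleftrightarrow> subgraph H G \<and> verts H = verts G"

definition graph_iso :: "'a ugraph \<Rightarrow> 'b ugraph \<Rightarrow> bool" where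
  "graph_iso G H \<longleftrightarrow>
     (\<exists>f. bij_betw f (verts G) (verts H) \<and> (\<lambda>e. f ` e) ` edges G = edges H)"

definition remove_isolated :: "'a ugraph \<Rightarrow> 'a ugraph" where
  "remove_isolated G = Graph {v \<in> verts G. \<exists>e \<in> edges G. v \<in> e} (edges G)"

definition complete_graph :: "nat \<Rightarrow> nat ugraph" where
  "complete_graph n = Graph {..<n} (nsets {..<n} 2)"

text \<open>The path with \<open>m\<close> vertices (and \<open>m - 1\<close> edges).\<close>

definition path_graph :: "nat \<Rightarrow> nat ugraph" where
  "path_graph m = Graph {..<m} {{i, Suc i} | i. Suc i < m}"

definition Mad :: "'a ugraph \<Rightarrow> real" where
  "Mad G = Max {2 * real (card (edges H)) / real (card (verts H)) | H.
                  subgraph H G \<and> card (verts H) \<ge> 1}"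

text \<open>Only the values \<open>G 1, \<dots>, G k\<close> matter. Parts with empty edge set are allowed.\<close>

definition edge_partition :: "nat \<Rightarrow> 'a ugraph \<Rightarrow> (nat \<Rightarrow> 'a ugraph) \<Rightarrow> bool" where
  "edge_partition k K G \<longleftrightarrow>
     (\<forall>i \<in> {1..k}. spanning_subgraph (G i) K) \<and>
     disjoint_family_on (\<lambda>i. edges (G i)) {1..k} \<and>
     (\<Union>i \<in> {1..k}. edges (G i)) = edges K"

definition M :: "nat \<Rightarrow> nat \<Rightarrow> real" where
  "M k n = Max {\<Sum>i = 1..k. Mad (G i) | G. edge_partition k (complete_graph n) G}"

definition extremal_partition :: "nat \<Rightarrow> nat \<Rightarrow> (nat \<Rightarrow> nat ugraph) \<Rightarrow> bool" where
  "extremal_partition k n G \<longleftrightarrow>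
     edge_partition k (complete_graph n) G \<and> (\<Sum>i = 1..k. Mad (G i)) = M k n"

definition parts_mset :: "nat \<Rightarrow> (nat \<Rightarrow> 'a ugraph) \<Rightarrow> 'a ugraph multiset" where
  "parts_mset k G = image_mset (\<lambda>i. remove_isolated (G i)) (mset_set {1..k})"

text \<open>Multisets of graphs are compared up to isomorphism of their members. That \<open>T\<close> is
  \<^emph>\<open>the\<close> extremal multiset means that \<open>T\<close> arises from an extremal partition and that every
  extremal partition gives \<open>T\<close>.\<close>

definition the_extremal_multiset :: "nat \<Rightarrow> nat \<Rightarrow> nat ugraph multiset \<Rightarrow> bool" where
  "the_extremal_multiset k n T \<longleftrightarrow>
     (\<exists>G. extremal_partition k n G \<and> rel_mset graph_iso (parts_mset k G) T) \<and>
     (\<forall>G. extremal_partition k n G \<longrightarrow> rel_mset graph_iso (parts_mset k G) T)"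

end

theory Submission
  imports Defs
begin

text \<open>
  A graph with \<open>e\<close> edges satisfies \<open>Mad G \<le> (e + 1) / 2\<close>, with equality exactly for a single edge and a
  triangle; otherwise the defect \<open>(e + 1) / 2 - Mad G\<close> is at least \<open>1 / 6\<close>, with equality exactly for
  \<open>P\<^sub>3\<close>. Summing over the parts gives \<open>M k n \<le> (n choose 2) - t / 2\<close>. For odd \<open>t\<close> some part has an even
  number of edges and hence a positive defect.

  Both bounds are attained once \<open>K\<^sub>n\<close> contains \<open>b \<le> (n - 1)\<^sup>2 / 6\<close> edge-disjoint triangles. These come from
  the Bose construction (\<open>n \<equiv> 3\<close> modulo 6, and \<open>n \<equiv> 2\<close> by deleting a point), the Skolem construction
  (\<open>n \<equiv> 0, 1\<close>) and a twisted Bose construction with one or two additional points (\<open>n \<equiv> 4, 5\<close>). For odd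
  \<open>t\<close> more than \<open>n / 2\<close> edges remain uncovered, so two of them are adjacent.
\<close>

section \<open>Packings of triples\<close>

text \<open>A partial Steiner triple system: the triples are the vertex sets of edge-disjoint
  triangles in the complete graph on \<open>V\<close>, and pairs of points may stay
  uncovered.\<close>

definition triple_packing :: "'a set \<Rightarrow> 'a set set \<Rightarrow> bool" where
  "triple_packing V T \<longleftrightarrow> (\<forall>A\<in>T. A \<subseteq> V \<and> card A = 3) \<and>
     (\<forall>A\<in>T. \<forall>B\<in>T. \<forall>u\<in>A \<inter> B. \<forall>v\<in>A \<inter> B. u \<noteq> v \<longrightarrow> A = B)"

lemma triple_packingI:
  assumes "\<And>A. A \<in> T \<Longrightarrow> A \<subseteq> V" "\<And>A. A \<in> T \<Longrightarrow> card A = 3"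
    and "\<And>A B u v. A \<in> T \<Longrightarrow> B \<in> T \<Longrightarrow> u \<noteq> v \<Longrightarrow> u \<in> A \<Longrightarrow> v \<in> A \<Longrightarrow> u \<in> B \<Longrightarrow> v \<in> B \<Longrightarrow> A = B"
  shows "triple_packing V T"
  using assms unfolding triple_packing_def by blast

lemma triple_packingD:
  assumes "triple_packing V T"
  shows "A \<in> T \<Longrightarrow> A \<subseteq> V" "A \<in> T \<Longrightarrow> card A = 3"
    and "A \<in> T \<Longrightarrow> B \<in> T \<Longrightarrow> u \<noteq> v \<Longrightarrow> u \<in> A \<Longrightarrow> v \<in> A \<Longrightarrow> u \<in> B \<Longrightarrow> v \<in> B \<Longrightarrow> A = B"
  using assms unfolding triple_packing_def by blast+

lemma triple_packing_finite: "triple_packing V T \<Longrightarrow> finite V \<Longrightarrow> finite T"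
  by (meson Pow_iff finite_Pow_iff finite_subset subsetI triple_packingD(1))

text \<open>The constructions live on convenient point sets and have whatever size comes out.
  Subfamilies of packings are packings, so exactly \<open>b\<close> triples can be kept, and a
  bijection moves them to \<open>{..<n}\<close>.\<close>

lemma triple_packing_transfer:
  assumes T: "triple_packing V T" and V: "finite V" "card V = n" and b: "b \<le> card T"
  shows "\<exists>S. triple_packing {..<n} S \<and> card S = b"
proof -
  obtain T' where T': "T' \<subseteq> T" "card T' = b"
    using b by (meson obtain_subset_with_card_n)
  obtain f where f: "bij_betw f V {..<n}"
    using V finite_same_card_bij[of V "{..<n}"] by auto
  have inj: "inj_on f V" and im: "f ` V = {..<n}" using f by (auto simp: bij_betw_def)
  have sub: "A \<subseteq> V" "card A = 3" if "A \<in> T'" for A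
    using that T' triple_packingD[OF T] by auto
  have "inj_on ((`) f) T'"
    using inj sub by (meson PowI inj_on_image_Pow inj_on_subset subsetI)
  then have c: "card ((`) f ` T') = b" using T' by (simp add: card_image)
  have "triple_packing {..<n} ((`) f ` T')"
  proof (rule triple_packingI)
    fix A assume "A \<in> (`) f ` T'"
    then show "A \<subseteq> {..<n}" "card A = 3"
      using im sub inj by (auto simp: card_image inj_on_subset)
  next
    fix A B u v assume "A \<in> (`) f ` T'" "B \<in> (`) f ` T'"
      and uv: "u \<noteq> v" "u \<in> A" "v \<in> A" "u \<in> B" "v \<in> B"
    then obtain A' B' where AB: "A = f ` A'" "B = f ` B'" "A' \<in> T'" "B' \<in> T'" by auto
    obtain u' v' where u': "u' \<in> A'" "v' \<in> A'" "u = f u'" "v = f v'" using uv AB by auto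
    have "u' \<in> B'" "v' \<in> B'"
      using u' uv AB sub inj by (meson inj_on_image_mem_iff subsetD)+
    then have "A' = B'"
      using triple_packingD(3)[OF T, of A' B' u' v'] u' uv AB T' by auto
    then show "A = B" using AB by simp
  qed
  with c show ?thesis by blast
qed

text \<open>\<open>E\<close> is a matching, so distinct new triples meet only in \<open>w\<close>.
  An old triple avoids \<open>w\<close>, so it could share two points with \<open>insert w e\<close>
  only by containing all of \<open>e\<close>, which \<open>unc\<close> excludes.\<close>

lemma triple_packing_add_point:
  assumes T: "triple_packing V T" and V: "finite V" "w \<notin> V"
    and E': "E \<subseteq> nsets V 2" "disjoint E"
    and unc: "\<forall>e\<in>E. \<forall>A\<in>T. \<not> e \<subseteq> A"
  shows "triple_packing (insert w V) (T \<union> insert w ` E)"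
    and "card (T \<union> insert w ` E) = card T + card E"
proof -
  have E: "\<And>e. e \<in> E \<Longrightarrow> e \<subseteq> V" "\<And>e. e \<in> E \<Longrightarrow> card e = 2"
    "\<And>e f. e \<in> E \<Longrightarrow> f \<in> E \<Longrightarrow> e \<noteq> f \<Longrightarrow> e \<inter> f = {}"
    using E' by (auto simp: nsets_def disjoint_def)
  have wE: "w \<notin> e" if "e \<in> E" for e using E(1) V that by blast
  have wT: "w \<notin> A" if "A \<in> T" for A using triple_packingD(1)[OF T] V that by blast
  have eq2: "e = {u, v}" if "e \<in> E" "u \<in> e" "v \<in> e" "u \<noteq> v" for e u v
    using E(2)[OF that(1)] that(2-) by (auto simp: card_2_iff)
  have mixed: False if "A \<in> T" "e \<in> E" "u \<noteq> v" "u \<in> A" "v \<in> A" "u \<in> insert w e" "v \<in> insert w e" for A e u v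
  proof -
    have "u \<in> e" "v \<in> e" using that wT by auto
    then show False using eq2[of e u v] that unc by auto
  qed
  show "triple_packing (insert w V) (T \<union> insert w ` E)"
  proof (rule triple_packingI)
    fix A assume "A \<in> T \<union> insert w ` E"
    then show "A \<subseteq> insert w V" using triple_packingD(1)[OF T] E(1) by blast
  next
    fix A assume "A \<in> T \<union> insert w ` E"
    then consider "A \<in> T" | e where "e \<in> E" "A = insert w e" by auto
    then show "card A = 3"
    proof cases
      case 2
      then have "finite e" using E(2) by (metis card.infinite zero_neq_numeral)
      then show ?thesis using 2 E(2) wE by auto
    qed (use triple_packingD[OF T] in auto)
  next
    fix A B u v
    assume AB: "A \<in> T \<union> insert w ` E" "B \<in> T \<union> insert w ` E"
      and uv: "u \<noteq> v" "u \<in> A" "v \<in> A" "u \<in> B" "v \<in> B"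
    consider "A \<in> T" "B \<in> T" | e where "A \<in> T" "e \<in> E" "B = insert w e"
      | e where "B \<in> T" "e \<in> E" "A = insert w e"
      | e f where "e \<in> E" "A = insert w e" "f \<in> E" "B = insert w f"
      using AB by auto
    then show "A = B"
    proof cases
      case 1 then show ?thesis using triple_packingD(3)[OF T] uv by blast
    next
      case 2 then show ?thesis using mixed uv by blast
    next
      case 3 then show ?thesis using mixed uv by blast
    next
      case 4
      then have "e \<inter> f \<noteq> {}" using uv by auto
      then show ?thesis using 4 E(3) by blast
    qed
  qed
  have fin: "finite T" "finite E"
    using T V E(1) by (auto intro: triple_packing_finite finite_subset[of E "Pow V"])
  have "T \<inter> insert w ` E = {}" using wT by auto
  moreover have "inj_on (insert w) E"
    using wE by (metis inj_onI insert_ident)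
  ultimately show "card (T \<union> insert w ` E) = card T + card E"
    using fin by (simp add: card_Un_disjoint card_image)
qed

text \<open>Distinct triples through \<open>w\<close> share no second point, so removing
  \<open>w\<close> from them leaves disjoint pairs in \<open>V\<close>; this bounds the number of
  triples lost.\<close>

lemma triple_packing_delete_point:
  assumes T: "triple_packing (insert w V) T" and V: "finite V" "w \<notin> V"
  shows "\<exists>S. triple_packing V S \<and> card T \<le> card S + card V div 2"
proof -
  define S R where "S = {A \<in> T. w \<notin> A}" and "R = {A \<in> T. w \<in> A}"
  have finT: "finite T" using triple_packing_finite[OF T] V by simp
  have "triple_packing V S"
    using T unfolding S_def triple_packing_def by blast
  moreover have "card T = card S + card R"
  proof -
    have "T = S \<union> R" "S \<inter> R = {}" unfolding S_def R_def by auto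
    then show ?thesis using finT by (metis card_Un_disjoint finite_Un)
  qed
  moreover have "card R \<le> card V div 2"
  proof -
    have fR: "finite R" using finT unfolding R_def by simp
    have "(\<Sum>A\<in>R. card (A - {w})) = card (\<Union>A\<in>R. A - {w})"
    proof (rule card_UN_disjoint[symmetric])
      show "\<forall>A\<in>R. finite (A - {w})"
        using triple_packingD(1)[OF T] V finite_subset unfolding R_def by fastforce
      show "\<forall>A\<in>R. \<forall>B\<in>R. A \<noteq> B \<longrightarrow> (A - {w}) \<inter> (B - {w}) = {}"
        using triple_packingD(3)[OF T] unfolding R_def by blast
    qed (fact fR)
    also have "\<dots> \<le> card V"
      using triple_packingD(1)[OF T] by (intro card_mono V) (auto simp: R_def)
    also have "(\<Sum>A\<in>R. card (A - {w})) = (\<Sum>A\<in>R. 2)"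
      using triple_packingD(2)[OF T] by (intro sum.cong) (auto simp: R_def)
    finally show ?thesis by simp
  qed
  ultimately show ?thesis by auto
qed

section \<open>Triple systems on three cyclic layers over commutative quasigroups\<close>

definition succ3 :: "nat \<Rightarrow> nat" where
  "succ3 a = Suc a mod 3"

lemma succ3_less: "succ3 a < 3"
  by (simp add: succ3_def)

lemma less_3_cases: "a < 3 \<Longrightarrow> a = 0 \<or> a = 1 \<or> a = (2::nat)"
  by linarith

lemma succ3_neq: "a < 3 \<Longrightarrow> succ3 a \<noteq> a" "a < 3 \<Longrightarrow> succ3 (succ3 a) \<noteq> a"
  by (drule less_3_cases; elim disjE; simp add: succ3_def)+

lemma succ3_eq_iff: "a < 3 \<Longrightarrow> b < 3 \<Longrightarrow> succ3 a = succ3 b \<longleftrightarrow> a = b"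
  by (drule less_3_cases, drule less_3_cases) (elim disjE; simp add: succ3_def)

text \<open>The generic block of the Bose and Skolem constructions. In a point, the first coordinate
  is the quasigroup element and the second the layer.\<close>

definition layer_triple :: "(nat \<Rightarrow> nat \<Rightarrow> nat \<Rightarrow> nat) \<Rightarrow> nat \<Rightarrow> nat \<Rightarrow> nat \<Rightarrow> (nat \<times> nat) set" where
  "layer_triple g a x y = {(x, a), (y, a), (g a x y, succ3 a)}"

definition layers :: "nat \<Rightarrow> (nat \<Rightarrow> nat \<Rightarrow> nat \<Rightarrow> nat) \<Rightarrow> (nat \<times> nat) set set" where
  "layers q g = {layer_triple g a x y | a x y. a < 3 \<and> x < y \<and> y < q}"

definition column :: "nat \<Rightarrow> (nat \<times> nat) set" where
  "column x = {x} \<times> {..<3}"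

text \<open>The pairs \<open>{u, next_layer g u}\<close> are exactly the pairs of points in different layers that no
  triple of \<open>layers\<close> covers; columns and triples through additional points are built from them.\<close>

definition next_layer :: "(nat \<Rightarrow> nat \<Rightarrow> nat \<Rightarrow> nat) \<Rightarrow> nat \<times> nat \<Rightarrow> nat \<times> nat" where
  "next_layer g u = (g (snd u) (fst u) (fst u), succ3 (snd u))"

text \<open>For each \<open>a\<close>, a commutative quasigroup on \<open>{..<q}\<close>, given by
  cancellation on a finite set. The diagonal \<open>g a x x\<close> is left open, because the
  constructions differ in where it is idempotent.\<close>

locale layer_ops =
  fixes q :: nat and g :: "nat \<Rightarrow> nat \<Rightarrow> nat \<Rightarrow> nat"
  assumes sym: "\<And>a x y. g a x y = g a y x"
    and less: "\<And>a x y. x < q \<Longrightarrow> y < q \<Longrightarrow> g a x y < q"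
    and inj: "\<And>a x y z. x < q \<Longrightarrow> y < q \<Longrightarrow> z < q \<Longrightarrow> g a x y = g a x z \<Longrightarrow> y = z"
begin

lemma layer_triple_sym: "layer_triple g a x y = layer_triple g a y x"
  unfolding layer_triple_def by (simp add: sym insert_commute)

lemma inj_iff: "x < q \<Longrightarrow> y < q \<Longrightarrow> z < q \<Longrightarrow> g a x y = g a x z \<longleftrightarrow> y = z"
  using inj by blast

text \<open>Commutativity allows swapping \<open>x\<close> and \<open>y\<close>, so the six ordered
  choices of two points reduce to three, at the price of \<open>x \<noteq> y\<close> in place of
  \<open>x < y\<close>.\<close>

lemma layersE:
  assumes "A \<in> layers q g" "u \<in> A" "v \<in> A" "u \<noteq> v"
  obtains a x y where "a < 3" "x < q" "y < q" "x \<noteq> y" "A = layer_triple g a x y" "u = (x, a)" "v = (y, a)"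
  | a x y where "a < 3" "x < q" "y < q" "x \<noteq> y" "A = layer_triple g a x y" "u = (x, a)" "v = (g a x y, succ3 a)"
  | a x y where "a < 3" "x < q" "y < q" "x \<noteq> y" "A = layer_triple g a x y" "v = (x, a)" "u = (g a x y, succ3 a)"
proof -
  obtain a x y where A: "A = layer_triple g a x y" "a < 3" "x < y" "y < q"
    using assms(1) unfolding layers_def by auto
  have u: "u = (x,a) \<or> u = (y,a) \<or> u = (g a x y, succ3 a)"
    and v: "v = (x,a) \<or> v = (y,a) \<or> v = (g a x y, succ3 a)"
    using assms(2,3) unfolding A(1) layer_triple_def by simp_all
  from A have q: "x < q" "x \<noteq> y" "y \<noteq> x" by auto
  have swap: "A = layer_triple g a y x" "g a x y = g a y x"
    using A(1) layer_triple_sym sym by metis+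
  from u v assms(4) consider "u = (x, a)" "v = (y, a)" | "u = (y, a)" "v = (x, a)"
    | "u = (x, a)" "v = (g a x y, succ3 a)" | "u = (y, a)" "v = (g a y x, succ3 a)"
    | "v = (x, a)" "u = (g a x y, succ3 a)" | "v = (y, a)" "u = (g a y x, succ3 a)"
    using swap(2) by metis
  then show ?thesis
  proof cases
    case 1 show ?thesis by (rule that(1)[OF A(2) q(1) A(4) q(2) A(1) 1])
  next
    case 2 show ?thesis by (rule that(1)[OF A(2) A(4) q(1) q(3) swap(1) 2])
  next
    case 3 show ?thesis by (rule that(2)[OF A(2) q(1) A(4) q(2) A(1) 3])
  next
    case 4 show ?thesis by (rule that(2)[OF A(2) A(4) q(1) q(3) swap(1) 4])
  next
    case 5 show ?thesis by (rule that(3)[OF A(2) q(1) A(4) q(2) A(1) 5])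
  next
    case 6 show ?thesis by (rule that(3)[OF A(2) A(4) q(1) q(3) swap(1) 6])
  qed
qed

text \<open>Two points of one layer are the \<open>x\<close> and \<open>y\<close> of their triple.
  Points \<open>(x, a)\<close> and \<open>(z, succ3 a)\<close> determine \<open>y\<close> by
  cancellation in \<open>g a x y = z\<close>, and \<open>succ3 (succ3 a) \<noteq> a\<close> settles
  which of the two layers is the lower one.\<close>

lemma layers_packing: "triple_packing ({..<q} \<times> {..<3}) (layers q g)"
proof (rule triple_packingI)
  fix A assume "A \<in> layers q g"
  then obtain a x y where A: "A = layer_triple g a x y" "a < 3" "x < y" "y < q"
    unfolding layers_def by auto
  show "A \<subseteq> {..<q} \<times> {..<3}" "card A = 3"
    using A less succ3_neq(1)[of a] succ3_less[of a] by (auto simp: layer_triple_def)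
next
  fix A B u v assume A: "A \<in> layers q g" and B: "B \<in> layers q g"
    and uv: "u \<noteq> v" "u \<in> A" "v \<in> A" "u \<in> B" "v \<in> B"
  show "A = B"
    by (rule layersE[OF A uv(2,3,1)]; rule layersE[OF B uv(4,5,1)]; clarsimp)
      (auto simp: succ3_neq succ3_eq_iff succ3_neq(1)[THEN not_sym] inj_iff)
qed

text \<open>A triple containing both points would give \<open>g a x y = g a x x\<close> with
  \<open>y \<noteq> x\<close>, against cancellation.\<close>

lemma layers_not_next:
  assumes "A \<in> layers q g" "fst u < q" "snd u < 3"
  shows "\<not> {u, next_layer g u} \<subseteq> A"
proof
  assume s: "{u, next_layer g u} \<subseteq> A"
  have ne: "u \<noteq> next_layer g u"
    using succ3_neq(1)[OF assms(3)] by (cases u) (auto simp: next_layer_def)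
  from s have s: "u \<in> A" "next_layer g u \<in> A" by auto
  show False
    by (rule layersE[OF assms(1) s ne]) (use assms in \<open>auto simp: next_layer_def inj_iff succ3_neq succ3_eq_iff\<close>)
qed

lemma card_layers: "card (layers q g) = 3 * (q choose 2)"
proof -
  define I where "I = {..<3::nat} \<times> (SIGMA y:{..<q}. {..<y})"
  have "layers q g = (\<lambda>(a, y, x). layer_triple g a x y) ` I"
    unfolding layers_def I_def image_def by (auto 4 4)
  moreover have "inj_on (\<lambda>(a, y, x). layer_triple g a x y) I"
  proof (rule inj_onI)
    fix p r
    assume *: "p \<in> I" "r \<in> I"
      "(case p of (a, y, x) \<Rightarrow> layer_triple g a x y) = (case r of (a, y, x) \<Rightarrow> layer_triple g a x y)"
    obtain a y x where p: "p = (a, y, x)" by (rule prod_cases3)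
    obtain b z w where r: "r = (b, z, w)" by (rule prod_cases3)
    note pr = p r
    with * have I: "(a, y, x) \<in> I" "(b, z, w) \<in> I" and eq: "layer_triple g a x y = layer_triple g b w z"
      by auto
    then have le: "a < 3" "b < 3" "x < y" "w < z" by (auto simp: I_def)
    \<comment> \<open>The other triple has two points in layer \<open>b\<close> and its third point
      alone in the next layer, so it can contain two points of layer \<open>a\<close> only if
      \<open>a = b\<close>.\<close>
    have "(x, a) \<in> layer_triple g b w z" "(y, a) \<in> layer_triple g b w z"
      using eq by (auto simp: layer_triple_def)
    then have "a = b \<and> x \<in> {w, z} \<and> y \<in> {w, z}"
      using le succ3_neq(1)[OF le(2)] by (auto simp: layer_triple_def)
    then show "p = r" using le pr by auto
  qed
  moreover have "card I = 3 * (q choose 2)"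
  proof -
    have "(\<Sum>y<q. y) = q choose 2"
      by (simp add: lessThan_atLeast0 Sum_Ico_nat choose_two)
    then show ?thesis unfolding I_def by (simp add: card_cartesian_product)
  qed
  ultimately show ?thesis by (simp only: card_image)
qed

definition "layers_columns S = layers q g \<union> column ` S"

text \<open>Where \<open>g\<close> is idempotent at \<open>x\<close> in all layers, the uncovered
  pairs starting over \<open>x\<close> are the three pairs within \<open>column x\<close>, so this
  triple fits in. Pairs starting outside \<open>S\<close> are not touched by the added
  columns.\<close>

lemma layers_columns:
  assumes S: "S \<subseteq> {..<q}" and idem: "\<forall>a<3. \<forall>x\<in>S. g a x x = x"
  shows "triple_packing ({..<q} \<times> {..<3}) (layers_columns S)"
    and "card (layers_columns S) = 3 * (q choose 2) + card S"
    and "A \<in> layers_columns S \<Longrightarrow> u \<in> ({..<q} - S) \<times> {..<3} \<Longrightarrow> \<not> {u, next_layer g u} \<subseteq> A"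
proof -
  have mixed: False if "A \<in> layers q g" "x \<in> S" "u \<noteq> v" "u \<in> A" "v \<in> A" "u \<in> column x" "v \<in> column x" for A x u v
  proof -
    define a b where "a = snd u" and "b = snd v"
    have ab: "u = (x, a)" "v = (x, b)" "a < 3" "b < 3"
      using that(6,7) by (auto simp: column_def a_def b_def)
    then have "a \<noteq> b" using that(3) by simp
    with ab have ab: "u = (x, a)" "v = (x, b)" "a < 3" "b < 3" "a \<noteq> b" by auto
    \<comment> \<open>Of two distinct layers among three in cyclic order, one always follows the
      other; so any two points of a column form an uncovered pair.\<close>
    have "b = succ3 a \<or> a = succ3 b" 
      using less_3_cases[OF ab(3)] less_3_cases[OF ab(4)] ab(5) by (elim disjE) (simp_all add: succ3_def)
    then have "v = next_layer g u \<or> u = next_layer g v"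
      using ab idem that by (auto simp: next_layer_def)
    then show False
      using layers_not_next[OF that(1), of u] layers_not_next[OF that(1), of v] that ab S by auto
  qed
  show "triple_packing ({..<q} \<times> {..<3}) (layers_columns S)"
  proof (rule triple_packingI)
    fix A assume "A \<in> layers_columns S"
    then show "A \<subseteq> {..<q} \<times> {..<3}" "card A = 3"
      using triple_packingD(1,2)[OF layers_packing] S
      by (auto simp: layers_columns_def column_def card_cartesian_product)
  next
    fix A B u v assume "A \<in> layers_columns S" "B \<in> layers_columns S"
      and uv: "u \<noteq> v" "u \<in> A" "v \<in> A" "u \<in> B" "v \<in> B"
    then consider "A \<in> layers q g" "B \<in> layers q g" | x where "A \<in> layers q g" "x \<in> S" "B = column x"
      | x where "B \<in> layers q g" "x \<in> S" "A = column x" | x y where "A = column x" "B = column y"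
      unfolding layers_columns_def by auto
    then show "A = B"
    proof cases
      case 1 then show ?thesis using triple_packingD(3)[OF layers_packing] uv by blast
    next
      case 2 then show ?thesis using mixed uv by blast
    next
      case 3 then show ?thesis using mixed uv by blast
    next
      case 4 then show ?thesis using uv by (auto simp: column_def)
    qed
  qed
  have "layers q g \<inter> column ` S = {}"
  proof -
    have "column x \<notin> layers q g" if "x \<in> S" for x
      using mixed[of "column x" x "(x, 0)" "(x, 1)"] that by (auto simp: column_def)
    then show ?thesis by blast
  qed
  moreover have "inj_on column S"
  proof (rule inj_onI)
    fix x y assume "column x = column y"
    moreover have "(x, 0) \<in> column x" by (simp add: column_def)
    ultimately have "(x, 0) \<in> column y" by simp
    then show "x = y" by (simp add: column_def)
  qed
  moreover have "finite (layers q g)" using triple_packing_finite[OF layers_packing] by simp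
  moreover have "finite S" using S finite_subset by blast
  ultimately show "card (layers_columns S) = 3 * (q choose 2) + card S"
    unfolding layers_columns_def by (simp add: card_Un_disjoint card_image card_layers)
  show "\<not> {u, next_layer g u} \<subseteq> A" if "A \<in> layers_columns S" "u \<in> ({..<q} - S) \<times> {..<3}"
    using that layers_not_next[of A u] by (auto simp: layers_columns_def column_def)
qed

end

text \<open>A matching given as a map: injectivity of \<open>\<phi>\<close> on \<open>D\<close> and
  disjointness of \<open>D\<close> from its image make the pairs \<open>{u, \<phi> u}\<close>
  disjoint and their number \<open>card D\<close>.\<close>

lemma triple_packing_add_point_map:
  assumes T: "triple_packing V T" and V: "finite V" "w \<notin> V"
    and D: "D \<subseteq> V" "\<phi> ` D \<subseteq> V" "inj_on \<phi> D" "\<phi> ` D \<inter> D = {}"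
    and unc: "\<forall>u\<in>D. \<forall>A\<in>T. \<not> {u, \<phi> u} \<subseteq> A"
  shows "triple_packing (insert w V) (T \<union> (\<lambda>u. {w, u, \<phi> u}) ` D)"
    and "card (T \<union> (\<lambda>u. {w, u, \<phi> u}) ` D) = card T + card D"
proof -
  define E where "E = (\<lambda>u. {u, \<phi> u}) ` D"
  have im: "insert w ` E = (\<lambda>u. {w, u, \<phi> u}) ` D" by (auto simp: E_def)
  have ne: "u \<noteq> \<phi> v" if "u \<in> D" "v \<in> D" for u v using D(4) that by auto
  have "inj_on (\<lambda>u. {u, \<phi> u}) D"
    using ne by (auto simp: inj_on_def doubleton_eq_iff)
  then have cE: "card E = card D" by (simp add: E_def card_image)
  have sub: "E \<subseteq> nsets V 2"
    using D ne by (auto simp: E_def nsets_def)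
  have disj: "disjoint E"
  proof (rule disjointI)
    fix e f assume "e \<in> E" "f \<in> E" "e \<noteq> f"
    obtain u v where uv: "e = {u, \<phi> u}" "f = {v, \<phi> v}" "u \<in> D" "v \<in> D"
      using \<open>e \<in> E\<close> \<open>f \<in> E\<close> by (auto simp: E_def)
    then have "u \<noteq> v" "\<phi> u \<noteq> \<phi> v" using \<open>e \<noteq> f\<close> D(3) by (auto simp: inj_on_def)
    then show "e \<inter> f = {}" using uv ne[of u v] ne[of v u] by auto
  qed
  have unc': "\<forall>e\<in>E. \<forall>A\<in>T. \<not> e \<subseteq> A" using unc by (auto simp: E_def)
  show "triple_packing (insert w V) (T \<union> (\<lambda>u. {w, u, \<phi> u}) ` D)"
    using triple_packing_add_point(1)[OF T V sub disj unc'] by (simp add: im)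
  show "card (T \<union> (\<lambda>u. {w, u, \<phi> u}) ` D) = card T + card D"
    using triple_packing_add_point(2)[OF T V sub disj unc'] by (simp add: im cE)
qed

section \<open>Quasigroups of odd and even order from modular addition\<close>

lemma add_mod_cancel_nat:
  fixes q x y z :: nat
  assumes "(x + y) mod q = (x + z) mod q" "y < q" "z < q"
  shows "y = z"
  using assms
proof (induction y z rule: linorder_wlog)
  case (le y z)
  then have "q dvd (x + z) - (x + y)" by (metis add_le_cancel_left mod_eq_dvd_iff_nat)
  then have "q dvd z - y" by simp
  then show ?case using le by (metis diff_is_0_eq dvd_imp_le le_antisym less_imp_diff_less not_le zero_less_iff_neq_zero)
qed simp

text \<open>\<open>m + 1\<close> is the inverse of 2 modulo \<open>2 * m + 1\<close>, so this is the
  half-sum of \<open>x\<close> and \<open>y\<close>, the idempotent commutative quasigroup used by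
  Bose.\<close>

definition midpoint_mod :: "nat \<Rightarrow> nat \<Rightarrow> nat \<Rightarrow> nat" where
  "midpoint_mod m x y = ((x + y) * (m + 1)) mod (2 * m + 1)"

lemma midpoint_mod_less: "midpoint_mod m x y < 2 * m + 1"
  by (simp add: midpoint_mod_def)

lemma midpoint_mod_sym: "midpoint_mod m x y = midpoint_mod m y x"
  by (simp add: midpoint_mod_def add.commute)

lemma midpoint_mod_idem: "x < 2 * m + 1 \<Longrightarrow> midpoint_mod m x x = x"
proof -
  assume x: "x < 2 * m + 1"
  have "(x + x) * (m + 1) = x + x * (2 * m + 1)" by algebra
  then have "midpoint_mod m x x = x mod (2 * m + 1)"
    unfolding midpoint_mod_def by (metis mod_mult_self1)
  then show ?thesis using x by (metis mod_less)
qed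

lemma midpoint_mod_inj:
  assumes "y < 2 * m + 1" "z < 2 * m + 1" "midpoint_mod m x y = midpoint_mod m x z"
  shows "y = z"
proof -
  \<comment> \<open>Doubling undoes the halving, which reduces cancellation for midpoints to
    cancellation for sums.\<close>
  have *: "(2 * midpoint_mod m x y) mod (2 * m + 1) = (x + y) mod (2 * m + 1)" for x y
  proof -
    have "2 * ((x + y) * (m + 1)) = (x + y) + (x + y) * (2 * m + 1)" by algebra
    then show ?thesis
      unfolding midpoint_mod_def by (metis mod_mult_right_eq mod_mult_self1)
  qed
  show ?thesis
    by (rule add_mod_cancel_nat[of x y "2 * m + 1" z]) (use assms *[of x y] *[of x z] in simp_all)
qed

text \<open>Negation modulo \<open>2 * m + 1\<close>; the case \<open>x = 0\<close> keeps the value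
  below the modulus.\<close>

definition neg_mod :: "nat \<Rightarrow> nat \<Rightarrow> nat" where
  "neg_mod m x = (if x = 0 then 0 else 2 * m + 1 - x)"

lemma bose_layer_ops: "layer_ops (2 * m + 1) (\<lambda>a. midpoint_mod m)"
  by unfold_locales (simp add: midpoint_mod_sym, rule midpoint_mod_less, rule midpoint_mod_inj)

text \<open>Negation permutes the residues, so cancellation survives. With the twist in a single
  layer, three steps of \<open>next_layer\<close> lead from \<open>x\<close> to its negative, so the
  uncovered pairs outside column 0 form cycles of even length instead of triangles.\<close>

lemma twisted_layer_ops:
  "layer_ops (2 * m + 1) (\<lambda>a x y. if a = 2 then neg_mod m (midpoint_mod m x y) else midpoint_mod m x y)"
proof
  fix a x y z assume le: "x < 2 * m + 1" "y < 2 * m + 1" "z < 2 * m + 1"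
    and eq: "(if a = 2 then neg_mod m (midpoint_mod m x y) else midpoint_mod m x y) =
      (if a = (2::nat) then neg_mod m (midpoint_mod m x z) else midpoint_mod m x z)"
  have "midpoint_mod m x y = midpoint_mod m x z"
    using eq midpoint_mod_less[of m x y] midpoint_mod_less[of m x z] by (auto simp: neg_mod_def split: if_splits)
  then show "y = z" using le midpoint_mod_inj by blast
qed (use midpoint_mod_sym midpoint_mod_less in \<open>auto simp: neg_mod_def\<close>)

text \<open>The half-idempotent commutative quasigroup of order \<open>2 * m\<close>: the sum modulo \<open>2 * m\<close>,
  relabelled so that \<open>x\<close> and \<open>m + x\<close> both have square \<open>x\<close> for \<open>x < m\<close>.\<close>

definition half_idem :: "nat \<Rightarrow> nat \<Rightarrow> nat \<Rightarrow> nat" where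
  "half_idem m x y = (let z = (x + y) mod (2 * m) in if even z then z div 2 else m + z div 2)"

lemma half_idem_diag: "half_idem m x x = x mod m"
proof -
  have "(x + x) mod (2 * m) = 2 * (x mod m)"
    by (simp only: mult_2[symmetric] mult_mod_right)
  then show ?thesis by (simp add: half_idem_def Let_def)
qed

text \<open>Addition modulo \<open>2 * m\<close> cancels, and the relabelling is injective: even
  sums go to values below \<open>m\<close>, odd sums to values from \<open>m\<close> on.\<close>

lemma skolem_layer_ops: "layer_ops (2 * m) (\<lambda>a. half_idem m)"
proof
  fix x y assume "x < 2 * m" "y < 2 * m"
  define s where "s = (x + y) mod (2 * m)"
  have "s < m * 2" using \<open>x < 2 * m\<close> by (simp add: s_def mult.commute)
  then have "s div 2 < m" by (rule less_mult_imp_div_less)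
  moreover have "half_idem m x y = (if even s then s div 2 else m + s div 2)"
    unfolding half_idem_def Let_def s_def ..
  ultimately show "half_idem m x y < 2 * m" by auto
next
  fix x y z assume le: "x < 2 * m" "y < 2 * m" "z < 2 * m" and eq: "half_idem m x y = half_idem m x z"
  define s t where "s = (x + y) mod (2 * m)" and "t = (x + z) mod (2 * m)"
  have "s < m * 2" "t < m * 2" using le by (simp_all add: s_def t_def mult.commute)
  then have "s div 2 < m" "t div 2 < m" by (auto intro: less_mult_imp_div_less)
  moreover have "(if even s then s div 2 else m + s div 2) = (if even t then t div 2 else m + t div 2)"
    using eq unfolding half_idem_def Let_def s_def t_def .
  ultimately have "even s \<longleftrightarrow> even t" "s div 2 = t div 2" by (auto split: if_splits)
  then have "s = t" by (metis div_mult_mod_eq mod2_eq_if)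
  then show "y = z" using add_mod_cancel_nat le unfolding s_def t_def by blast
qed (simp add: half_idem_def add.commute)

lemma choose_two_double: "(2 * m choose 2) + m = 2 * m * m" "(2 * m + 1 choose 2) = 2 * m * m + m"
proof -
  have "2 * (2 * m choose 2) = 2 * m * (2 * m - 1)" by (simp add: choose_two)
  then have "(2 * m choose 2) = m * (2 * m - 1)" by simp
  then show "(2 * m choose 2) + m = 2 * m * m" by (cases m) (simp_all add: algebra_simps)
  have "2 * (2 * m + 1 choose 2) = (2 * m + 1) * (2 * m)" by (simp add: choose_two)
  then have "(2 * m + 1 choose 2) = (2 * m + 1) * m" by simp
  then show "(2 * m + 1 choose 2) = 2 * m * m + m" by (simp add: algebra_simps)
qed

section \<open>Packings for the residue classes of \<open>n\<close> modulo 6\<close>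

text \<open>Skolem construction. Squares of \<open>x < m\<close> are \<open>x\<close>, so the
  columns below \<open>m\<close> fit in and give \<open>T\<close>. The remaining uncovered pairs
  join \<open>(x, a)\<close> with \<open>m \<le> x\<close> to \<open>(x - m, succ3 a)\<close>; they
  form a perfect matching, which the point \<open>(0, 3)\<close> completes to \<open>3 * m\<close>
  further triples.\<close>

lemma ex_packing_6m_1:
  obtains T T' :: "(nat \<times> nat) set set"
  where "triple_packing ({..<2 * m} \<times> {..<3}) T" "card T + 2 * m = 6 * m * m"
    "triple_packing (insert (0, 3) ({..<2 * m} \<times> {..<3})) T'" "card T' = 6 * m * m + m"
proof -
  let ?g = "\<lambda>a::nat. half_idem m"
  interpret layer_ops "2 * m" ?g by (rule skolem_layer_ops)
  define T where "T = layers_columns {..<m}"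
  have S: "{..<m} \<subseteq> {..<2 * m}" by auto
  have idem: "\<forall>a<3. \<forall>x\<in>{..<m}. ?g a x x = x"
    by (simp add: half_idem_diag)
  note T = layers_columns[OF S idem, folded T_def]
  have "card T + 2 * m = 6 * m * m"
    using T(2) choose_two_double(1)[of m] unfolding card_lessThan by linarith
  define D where "D = {m..<2 * m} \<times> {..<3::nat}"
  have nx: "next_layer ?g u = (fst u - m, succ3 (snd u))" if "u \<in> D" for u
  proof -
    have "fst u mod m = fst u - m" using that by (cases u) (auto simp: D_def le_mod_geq)
    then show ?thesis by (simp add: next_layer_def half_idem_diag)
  qed
  have D: "D \<subseteq> {..<2 * m} \<times> {..<3}" "next_layer ?g ` D \<subseteq> {..<2 * m} \<times> {..<3}"
    "next_layer ?g ` D \<inter> D = {}"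
    using nx succ3_less by (auto simp: D_def)
  have inj: "inj_on (next_layer ?g) D"
  proof (rule inj_onI)
    fix u v assume uv: "u \<in> D" "v \<in> D" "next_layer ?g u = next_layer ?g v"
    then have "fst u - m = fst v - m" "succ3 (snd u) = succ3 (snd v)" using nx by auto
    then show "u = v" using uv(1,2) by (auto simp: D_def succ3_eq_iff)
  qed
  have "\<not> {u, next_layer ?g u} \<subseteq> A" if "u \<in> D" "A \<in> T" for u A
    using T(3)[OF that(2), of u] that(1) by (auto simp: D_def)
  then have unc: "\<forall>u\<in>D. \<forall>A\<in>T. \<not> {u, next_layer ?g u} \<subseteq> A" by blast
  have "finite ({..<2 * m} \<times> {..<3::nat})" "(0, 3) \<notin> {..<2 * m} \<times> {..<3::nat}" by auto
  note T' = triple_packing_add_point_map[OF T(1) this D(1,2) inj D(3) unc]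
  have "card D = 3 * m" by (simp add: D_def card_cartesian_product)
  with T'(2) \<open>card T + 2 * m = 6 * m * m\<close>
  have "card (T \<union> (\<lambda>u. {(0, 3), u, next_layer ?g u}) ` D) = 6 * m * m + m" by simp
  with T(1) \<open>card T + 2 * m = 6 * m * m\<close> T'(1) show thesis by (rule that)
qed

text \<open>Bose construction: midpoints are idempotent everywhere, so all columns fit. The size is
  a third of the number of all pairs, so this is a Steiner triple system.\<close>

lemma ex_packing_6m_3:
  obtains T :: "(nat \<times> nat) set set"
  where "triple_packing ({..<2 * m + 1} \<times> {..<3}) T" "card T = 6 * m * m + 5 * m + 1"
proof -
  interpret layer_ops "2 * m + 1" "\<lambda>a::nat. midpoint_mod m" by (rule bose_layer_ops)
  have "\<forall>a<3::nat. \<forall>x\<in>{..<2 * m + 1}. midpoint_mod m x x = x"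
    using midpoint_mod_idem by blast
  note T = layers_columns[OF order_refl this]
  have "card (layers_columns {..<2 * m + 1}) = 6 * m * m + 5 * m + 1"
    unfolding T(2) choose_two_double(2) by simp
  with T(1) show thesis by (rule that)
qed

text \<open>The twisted operation is idempotent in all layers only at 0, so one column is used. Each
  new point takes a perfect matching of the points outside column 0; the second one also forms a
  triple with the first and a point of column 0.\<close>

lemma ex_packing_6m_5:
  obtains T T' :: "(nat \<times> nat) set set"
  where "triple_packing (insert (0, 3) ({..<2 * m + 1} \<times> {..<3})) T" "card T = 6 * m * m + 6 * m + 1"
    "triple_packing (insert (1, 3) (insert (0, 3) ({..<2 * m + 1} \<times> {..<3}))) T'"
    "card T' = 6 * m * m + 9 * m + 2"
proof -
  define g where "g = (\<lambda>a x y. if a = (2::nat) then neg_mod m (midpoint_mod m x y) else midpoint_mod m x y)"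
  interpret layer_ops "2 * m + 1" g unfolding g_def by (rule twisted_layer_ops)
  define V where "V = {..<2 * m + 1} \<times> {..<3::nat}"
  define T0 where "T0 = layers_columns {0}"
  have S: "{0} \<subseteq> {..<2 * m + 1}" by auto
  have idem: "\<forall>a<3. \<forall>x\<in>{0}. g a x x = x"
    by (auto simp: g_def neg_mod_def midpoint_mod_idem)
  note T0 = layers_columns[OF S idem, folded T0_def V_def]
  have cT0: "card T0 = 6 * m * m + 3 * m + 1"
    unfolding T0(2) choose_two_double(2) by simp
  define \<phi> where "\<phi> = next_layer g"
  have \<phi>: "\<phi> u = (if snd u = 2 then neg_mod m (fst u) else fst u, succ3 (snd u))" if "u \<in> V" for u
    using that by (auto simp: \<phi>_def next_layer_def g_def midpoint_mod_idem V_def)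
  have inj: "inj_on \<phi> V"
  proof (rule inj_onI)
    fix u v assume uv: "u \<in> V" "v \<in> V" "\<phi> u = \<phi> v"
    then have "succ3 (snd u) = succ3 (snd v)" using \<phi> by auto
    then have s: "snd u = snd v" using uv by (auto simp: V_def succ3_eq_iff)
    with uv have "fst u = fst v"
      by (auto simp: \<phi> V_def neg_mod_def split: if_splits)
    with s show "u = v" by (simp add: prod_eq_iff)
  qed
  have \<phi>V: "\<phi> u \<in> V" if "u \<in> V" for u
    using that by (auto simp: \<phi> V_def succ3_less neg_mod_def)
  have \<phi>\<phi>: "\<phi> (\<phi> u) \<noteq> u" if "u \<in> V" for u
    using \<phi>[OF that] \<phi>[OF \<phi>V[OF that]] succ3_neq(2)[of "snd u"] that
    by (auto simp: V_def prod_eq_iff)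
  have \<phi>0: "fst (\<phi> u) \<noteq> 0" if "u \<in> V" "fst u \<noteq> 0" for u
    using that by (auto simp: \<phi> neg_mod_def V_def)

  text \<open>The pairs \<open>{u, \<phi> u}\<close> with \<open>fst u \<noteq> 0\<close> form 6-cycles, each of which splits into two perfect
    matchings, one for either of the two points that are added.\<close>

  define L H where "L = {1..m}" and "H = {m+1..2 * m}"
  \<comment> \<open>Negation exchanges \<open>L\<close> and \<open>H\<close>, so
    \<open>\<phi>\<close> runs cyclically through \<open>L \<times> {0}\<close>,
    \<open>L \<times> {1}\<close>, \<open>L \<times> {2}\<close>, \<open>H \<times> {0}\<close>,
    \<open>H \<times> {1}\<close>, \<open>H \<times> {2}\<close>; \<open>D\<close> and
    \<open>D'\<close> take these blocks alternately.\<close>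
  define D where "D = L \<times> {0, 2::nat} \<union> H \<times> {1}"
  define D' where "D' = L \<times> {1} \<union> H \<times> {0, 2::nat}"
  have DV: "D \<subseteq> V" "D' \<subseteq> V" by (auto simp: D_def D'_def V_def L_def H_def)
  have D0: "fst u \<noteq> 0" if "u \<in> D \<union> D'" for u
    using that by (auto simp: D_def D'_def L_def H_def)
  have DD': "D \<inter> D' = {}" by (auto simp: D_def D'_def L_def H_def)
  have \<phi>D: "\<phi> u \<in> D'" if "u \<in> D" for u
    using that \<phi>[OF subsetD[OF DV(1) that]] by (auto simp: D_def D'_def L_def H_def neg_mod_def succ3_def)
  have \<phi>D': "\<phi> u \<in> D" if "u \<in> D'" for u
    using that \<phi>[OF subsetD[OF DV(2) that]] by (auto simp: D_def D'_def L_def H_def neg_mod_def succ3_def)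
  have cards: "card D = 3 * m" "card D' = 3 * m"
  proof -
    have "L \<inter> H = {}" "finite L" "finite H" "card L = m" "card H = m" by (auto simp: L_def H_def)
    moreover from this have "L \<times> X \<inter> H \<times> Y = {}" for X Y :: "nat set" by auto
    ultimately show "card D = 3 * m" "card D' = 3 * m"
      unfolding D_def D'_def by (simp_all add: card_Un_disjoint card_cartesian_product)
  qed
  have finV: "finite V" by (simp add: V_def)
  have w: "(0, 3) \<notin> V" by (simp add: V_def)
  have unc0: "\<not> {u, \<phi> u} \<subseteq> A" if "u \<in> D \<union> D'" "A \<in> T0" for u A
    using T0(3)[OF that(2), of u] that(1) DV D0[OF that(1)] unfolding \<phi>_def by (auto simp: V_def)
  define T where "T = T0 \<union> (\<lambda>u. {(0, 3), u, \<phi> u}) ` D"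
  have T: "triple_packing (insert (0, 3) V) T" "card T = card T0 + card D"
    unfolding T_def
    by (rule triple_packing_add_point_map[OF T0(1) finV w];
        use DV \<phi>V \<phi>D DD' unc0 inj in \<open>auto intro: inj_on_subset\<close>)+
  \<comment> \<open>The second point uses the matching that starts in \<open>D'\<close> and also the
    pair of \<open>(0, 3)\<close> and \<open>(0, 0)\<close>. That pair is free, because triples
    through \<open>(0, 3)\<close> have their other points outside column 0; it gives the
    \<open>+ 1\<close> in \<open>card E\<close>.\<close>
  define \<psi> where "\<psi> = \<phi>((0, 3) := (0, 0))"
  define E where "E = insert (0, 3) D'"
  have wE: "(1, 3) \<notin> insert (0, 3) V" by (simp add: V_def)
  have w0: "(0, 0) \<in> V" by (simp add: V_def)
  have \<psi>D': "\<psi> u = \<phi> u" if "u \<in> D'" for u using that w DV by (auto simp: \<psi>_def)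
  have \<psi>E: "\<psi> ` E = insert (0, 0) (\<phi> ` D')"
  proof -
    have "\<psi> ` D' = \<phi> ` D'" by (rule image_cong[OF refl \<psi>D'])
    moreover have "\<psi> (0, 3) = (0, 0)" by (simp add: \<psi>_def)
    ultimately show ?thesis by (simp add: E_def)
  qed
  have injE: "inj_on \<psi> E"
  proof -
    have "inj_on \<phi> D'" using inj DV(2) by (rule inj_on_subset)
    then have "inj_on \<psi> D'" by (simp add: inj_on_def \<psi>D')
    moreover have "(0, 0) \<notin> \<psi> ` D'"
    proof
      assume "(0, 0) \<in> \<psi> ` D'"
      then obtain u where u: "u \<in> D'" "\<phi> u = (0, 0)" using \<psi>D' by auto
      then show False using \<phi>0[of u] D0[of u] DV by auto
    qed
    moreover have "D' - {(0, 3)} = D'" using DV w by auto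
    ultimately show ?thesis by (simp add: E_def \<psi>_def)
  qed
  have disjE: "\<psi> ` E \<inter> E = {}"
  proof -
    have "(0, 0) \<notin> D'" using D0[of "(0, 0)"] by auto
    moreover have "\<phi> ` D' \<subseteq> D" using \<phi>D' by (rule image_subsetI)
    then have "\<phi> ` D' \<inter> D' = {}" "(0, 3) \<notin> \<phi> ` D'" using DD' DV w by blast+
    ultimately show ?thesis unfolding \<psi>E by (simp add: E_def)
  qed
  have "\<phi> ` D' \<subseteq> V" using \<phi>V DV(2) by blast
  then have EV: "E \<subseteq> insert (0, 3) V" "\<psi> ` E \<subseteq> insert (0, 3) V"
    using DV(2) w0 unfolding \<psi>E by (auto simp: E_def)
  have "\<not> {u, \<psi> u} \<subseteq> A" if u: "u \<in> E" and A: "A \<in> T" for u A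
  proof
    assume s: "{u, \<psi> u} \<subseteq> A"
    consider "A \<in> T0" | v where "v \<in> D" "A = {(0, 3), v, \<phi> v}" using A by (auto simp: T_def)
    then show False
    proof cases
      case 1
      then have "A \<subseteq> V" using triple_packingD(1)[OF T0(1)] by blast
      then have "u \<in> D'" using s u w by (auto simp: E_def)
      then show False using unc0[of u A] s 1 \<psi>D' by auto
    next
      case 2
      have v: "v \<in> V" "fst v \<noteq> 0" using 2 DV D0[of v] by auto
      then have v: "v \<in> V" "\<phi> v \<in> V" "fst v \<noteq> 0" "fst (\<phi> v) \<noteq> 0" using \<phi>V[of v] \<phi>0[of v] by auto
      show False
      proof (cases "u = (0, 3)")
        case True
        then have "(0, 0) \<in> A" using s by (simp add: \<psi>_def)
        then have "(0, 0) = v \<or> (0, 0) = \<phi> v" using 2 by simp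
        then show False using v by (metis fst_conv)
      next
        case False
        then have u': "u \<in> D'" "\<psi> u = \<phi> u" using u \<psi>D' by (auto simp: E_def)
        then have "u \<in> V" "\<phi> u \<in> V" using DV \<phi>V[of u] by auto
        \<comment> \<open>Since \<open>D\<close> and \<open>D'\<close> are disjoint, a covered pair
          would make \<open>u\<close> and \<open>v\<close> a 2-cycle of \<open>\<phi>\<close>, which
          \<open>\<phi>\<phi>\<close> excludes.\<close>
        then have "u \<in> {v, \<phi> v}" "\<phi> u \<in> {v, \<phi> v}" using s 2 u' w by auto
        moreover have "u \<noteq> v" using u' 2 DD' by auto
        ultimately have "u = \<phi> v" "\<phi> u = v" using inj v \<open>u \<in> V\<close> by (auto dest: inj_onD)
        then show False using \<phi>\<phi>[OF v(1)] by simp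
      qed
    qed
  qed
  then have unc: "\<forall>u\<in>E. \<forall>A\<in>T. \<not> {u, \<psi> u} \<subseteq> A" by blast
  have "finite (insert (0, 3) V)" using finV by simp
  note T' = triple_packing_add_point_map[OF T(1) this wE EV injE disjE unc]
  have "(0, 3) \<notin> D'" "finite D'" using DV w finV finite_subset by auto
  then have cE: "card E = 3 * m + 1" using cards by (simp add: E_def)
  show thesis
  proof (rule that)
    show "triple_packing (insert (0, 3) ({..<2 * m + 1} \<times> {..<3})) T"
      using T(1) unfolding V_def .
    show "triple_packing (insert (1, 3) (insert (0, 3) ({..<2 * m + 1} \<times> {..<3})))
        (T \<union> (\<lambda>u. {(1, 3), u, \<psi> u}) ` E)"
      using T'(1) unfolding V_def .
    show "card T = 6 * m * m + 6 * m + 1" using T(2) cT0 cards by simp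
    then show "card (T \<union> (\<lambda>u. {(1, 3), u, \<psi> u}) ` E) = 6 * m * m + 9 * m + 2"
      using T'(2) cE by simp
  qed
qed

text \<open>In each residue class the constructions reach the integer part of
  \<open>(n - 1)\<^sup>2 / 6\<close>. For even \<open>n\<close> the sizes guaranteed below equal it
  exactly; for odd \<open>n\<close> there is slack once \<open>m > 0\<close>.\<close>

theorem ex_triple_packing:
  assumes "n \<ge> 1" "6 * b \<le> (n - 1)\<^sup>2"
  shows "\<exists>T. triple_packing {..<n} T \<and> card T = b"
proof -
  define m r where "m = n div 6" and "r = n mod 6"
  have n: "n = 6 * m + r" "r < 6" by (simp_all add: m_def r_def)
  then consider "r = 0" | "r = 1" | "r = 2" | "r = 3" | "r = 4" | "r = 5" by linarith
  then show ?thesis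
  proof cases
    case 1
    \<comment> \<open>Here \<open>n \<ge> 1\<close> forces \<open>m > 0\<close>, so that
      \<open>n - 1\<close> is \<open>6 * m - 1\<close> without truncation.\<close>
    then obtain j where "m = Suc j" using n assms by (cases m) auto
    with 1 n assms have "6 * b \<le> 36 * m * m - 12 * m + 1"
      by (simp add: power2_eq_square algebra_simps)
    then have "b + 2 * m \<le> 6 * m * m" using \<open>m = Suc j\<close> by (simp add: algebra_simps)
    moreover obtain T :: "(nat \<times> nat) set set"
      where "triple_packing ({..<2 * m} \<times> {..<3}) T" "card T + 2 * m = 6 * m * m"
      by (rule ex_packing_6m_1)
    ultimately show ?thesis
      using 1 n by (intro triple_packing_transfer[of "{..<2 * m} \<times> {..<3}" T]) (auto simp: card_cartesian_product)
  next
    case 2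
    then have "b \<le> 6 * m * m + m" using n assms by (simp add: power2_eq_square algebra_simps)
    moreover obtain T :: "(nat \<times> nat) set set"
      where "triple_packing (insert (0, 3) ({..<2 * m} \<times> {..<3})) T" "card T = 6 * m * m + m"
      by (rule ex_packing_6m_1)
    ultimately show ?thesis
      using 2 n by (intro triple_packing_transfer[of _ T]) (auto simp: card_cartesian_product)
  next
    case 3
    then have b: "b \<le> 6 * m * m + 2 * m" using n assms by (simp add: power2_eq_square algebra_simps)
    obtain T :: "(nat \<times> nat) set set"
      where T: "triple_packing ({..<2 * m + 1} \<times> {..<3}) T" "card T = 6 * m * m + 5 * m + 1"
      by (rule ex_packing_6m_3)
    \<comment> \<open>Deleting one point from the system on \<open>6 * m + 3\<close> points costs at
      most \<open>3 * m + 1\<close> triples and leaves at least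
      \<open>6 * m * m + 2 * m\<close>.\<close>
    define V where "V = {..<2 * m + 1} \<times> {..<3::nat} - {(0, 0)}"
    have V: "insert (0, 0) V = {..<2 * m + 1} \<times> {..<3}" "finite V" "(0, 0) \<notin> V" by (auto simp: V_def)
    have cV: "card V = 6 * m + 2" by (simp add: V_def card_cartesian_product)
    obtain S where "triple_packing V S" "card T \<le> card S + card V div 2"
      using triple_packing_delete_point[of "(0, 0)" V T] T V by auto
    then show ?thesis
      using b 3 n cV V T by (intro triple_packing_transfer[of _ S]) auto
  next
    case 4
    then have "b \<le> 6 * m * m + 5 * m + 1" using n assms by (simp add: power2_eq_square algebra_simps)
    moreover obtain T :: "(nat \<times> nat) set set"
      where T: "triple_packing ({..<2 * m + 1} \<times> {..<3}) T" "card T = 6 * m * m + 5 * m + 1"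
      by (rule ex_packing_6m_3)
    ultimately show ?thesis
      using 4 n by (intro triple_packing_transfer[of _ T]) (auto simp: card_cartesian_product)
  next
    case 5
    then have "b \<le> 6 * m * m + 6 * m + 1" using n assms by (simp add: power2_eq_square algebra_simps)
    moreover obtain T :: "(nat \<times> nat) set set"
      where "triple_packing (insert (0, 3) ({..<2 * m + 1} \<times> {..<3})) T" "card T = 6 * m * m + 6 * m + 1"
      by (rule ex_packing_6m_5)
    ultimately show ?thesis
      using 5 n by (intro triple_packing_transfer[of _ T]) (auto simp: card_cartesian_product)
  next
    case 6
    then have "b \<le> 6 * m * m + 9 * m + 2" using n assms by (simp add: power2_eq_square algebra_simps)
    moreover obtain T :: "(nat \<times> nat) set set"
      where "triple_packing (insert (1, 3) (insert (0, 3) ({..<2 * m + 1} \<times> {..<3}))) T"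
        "card T = 6 * m * m + 9 * m + 2"
      by (rule ex_packing_6m_5)
    ultimately show ?thesis
      using 6 n by (intro triple_packing_transfer[of _ T]) (auto simp: card_cartesian_product)
  qed
qed

section \<open>Maximum average degree\<close>

lemma finite_graph_edges: "finite_graph G \<Longrightarrow> finite (edges G)"
  by (meson finite_graph_def finite_imp_finite_nsets finite_subset)

lemma subgraph_finite: "finite_graph G \<Longrightarrow> finite {H. subgraph H G}"
proof -
  assume G: "finite_graph G"
  have "{H. subgraph H G} \<subseteq> (\<lambda>(W, E). Graph W E) ` (Pow (verts G) \<times> Pow (edges G))"
  proof
    fix H assume "H \<in> {H. subgraph H G}"
    then have "(verts H, edges H) \<in> Pow (verts G) \<times> Pow (edges G)" by (auto simp: subgraph_def)
    then show "H \<in> (\<lambda>(W, E). Graph W E) ` (Pow (verts G) \<times> Pow (edges G))"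
      by (metis (no_types, lifting) case_prod_conv image_eqI ugraph.collapse)
  qed
  moreover have "finite (edges G)"
    using G by (rule finite_graph_edges)
  ultimately show ?thesis
    using G by (meson finite_Pow_iff finite_SigmaI finite_graph_def finite_imageI finite_subset)
qed

lemma finite_Mad_values:
  "finite_graph G \<Longrightarrow>
    finite {2 * real (card (edges H)) / real (card (verts H)) | H. subgraph H G \<and> card (verts H) \<ge> 1}"
  by (intro finite_image_set finite_subset[OF _ subgraph_finite[of G]]) auto

lemma Mad_ge:
  assumes "finite_graph G" "subgraph H G" "card (verts H) \<ge> 1"
  shows "2 * real (card (edges H)) / real (card (verts H)) \<le> Mad G"
  unfolding Mad_def using assms by (intro Max_ge finite_Mad_values) auto

lemma Mad_attained:
  assumes "finite_graph G" "verts G \<noteq> {}"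
  obtains H where "subgraph H G" "card (verts H) \<ge> 1"
    "Mad G = 2 * real (card (edges H)) / real (card (verts H))"
proof -
  let ?X = "{2 * real (card (edges H)) / real (card (verts H)) | H. subgraph H G \<and> card (verts H) \<ge> 1}"
  have "subgraph G G" "card (verts G) \<ge> 1"
    using assms by (auto simp: subgraph_def finite_graph_def Suc_le_eq card_gt_0_iff)
  then have "?X \<noteq> {}" by blast
  then have "Mad G \<in> ?X" unfolding Mad_def using finite_Mad_values[OF assms(1)] by (intro Max_in)
  then show thesis using that by blast
qed

section \<open>Graphs classified by \<open>Mad\<close> against the number of edges\<close>

lemma graph_iso_complete:
  assumes "finite V" "card V = n"
  shows "graph_iso (Graph V (nsets V 2)) (complete_graph n)"
proof -
  obtain f where f: "bij_betw f V {..<n}"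
    using assms finite_same_card_bij[of V "{..<n}"] by auto
  then have "(\<lambda>e. f ` e) ` nsets V 2 = nsets {..<n} 2"
    using bij_betw_nsets[OF f] by (simp add: bij_betw_def)
  with f show ?thesis unfolding graph_iso_def complete_graph_def by auto
qed

lemma remove_isolated_complete:
  assumes "edges G = nsets V 2" "V \<subseteq> verts G" "finite V" "card V \<ge> 2"
  shows "remove_isolated G = Graph V (nsets V 2)"
proof -
  have "\<exists>e\<in>nsets V 2. v \<in> e" if "v \<in> V" for v
  proof -
    have "card (V - {v}) \<noteq> 0" using assms that by simp
    then have "V - {v} \<noteq> {}" by force
    then obtain u where "u \<in> V" "u \<noteq> v" by auto
    then have "{u, v} \<in> nsets V 2" using that by (auto simp: nsets_def)
    then show ?thesis by blast
  qed
  then show ?thesis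
    using assms by (auto simp: remove_isolated_def nsets_def)
qed

lemma graph_iso_path3:
  assumes "a \<noteq> b" "b \<noteq> c" "a \<noteq> c"
  shows "graph_iso (Graph {a, b, c} {{a, b}, {b, c}}) (path_graph 3)"
proof -
  define f where "f = (\<lambda>x. if x = a then 0 else if x = b then 1 else (2::nat))"
  have "bij_betw f {a, b, c} {..<3}"
    using assms by (auto simp: bij_betw_def inj_on_def f_def)
  moreover have "{{i, Suc i} |i. Suc i < 3} = {{0, 1}, {1, 2}}"
  proof -
    have "Suc i < 3 \<longleftrightarrow> i = 0 \<or> i = 1" for i by auto
    then show ?thesis by (auto simp: numeral_2_eq_2)
  qed
  moreover have "(\<lambda>e. f ` e) ` {{a, b}, {b, c}} = {{0, 1}, {1, 2}}"
    using assms by (auto simp: f_def)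
  ultimately show ?thesis unfolding graph_iso_def path_graph_def by auto
qed

text \<open>Two disjoint edges would need four vertices, so the edges share an endpoint, which
  becomes the middle vertex \<open>b\<close>.\<close>

lemma two_edges_three_vertices:
  assumes "card V = 3" "E \<subseteq> nsets V 2" "card E = 2"
  obtains a b c where "a \<noteq> b" "b \<noteq> c" "a \<noteq> c" "V = {a, b, c}" "E = {{a, b}, {b, c}}"
proof -
  obtain e f where ef: "E = {e, f}" "e \<noteq> f" using assms(3) by (meson card_2_iff)
  have fin: "finite V" using assms(1) by (metis card.infinite zero_neq_numeral)
  have e: "e \<subseteq> V" "card e = 2" "f \<subseteq> V" "card f = 2" using assms(2) ef by (auto simp: nsets_def)
  then have fe: "finite e" "finite f" using fin finite_subset by auto
  have "card (e \<union> f) \<le> 3" using assms(1) e fin by (metis Un_least card_mono)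
  moreover have "card (e \<union> f) + card (e \<inter> f) = 4" using card_Un_Int[OF fe] e by simp
  ultimately have "e \<inter> f \<noteq> {}" by auto
  then obtain b where b: "b \<in> e" "b \<in> f" by auto
  obtain a where a: "e = {a, b}" "a \<noteq> b"
    using e(2) b(1) by (auto simp: card_2_iff doubleton_eq_iff)
  obtain c where c: "f = {b, c}" "b \<noteq> c"
    using e(4) b(2) by (auto simp: card_2_iff doubleton_eq_iff)
  have ac: "a \<noteq> c" using a c ef by auto
  have "{a, b, c} \<subseteq> V" using a c e by auto
  moreover have "card {a, b, c} = card V" using a c ac assms(1) by simp
  ultimately have "{a, b, c} = V" using fin by (metis card_subset_eq)
  then show thesis using that[of a b c] a c ac ef by auto
qed

lemma card_edges_le:
  assumes "finite_graph H"
  shows "card (edges H) \<le> card (verts H) choose 2"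
  using assms by (metis card_mono card_nsets finite_graph_def finite_imp_finite_nsets)

text \<open>A densest subgraph \<open>H\<close> with \<open>v\<close> vertices and \<open>h\<close>
  edges has \<open>h \<le> e\<close> and \<open>h \<le> v choose 2\<close>. For
  \<open>v \<ge> 4\<close> this gives \<open>Mad G \<le> e / 2\<close>; for \<open>v \<le> 3\<close>
  it bounds \<open>h\<close> by 3, and the three named graphs are the only exceptions to the strict
  bound, whose \<open>1 / 6\<close> is the value for \<open>P_3\<close>.\<close>

lemma Mad_cases:
  assumes G: "finite_graph G" "verts G \<noteq> {}"
  obtains (K2) "card (edges G) = 1" "Mad G = 1" "graph_iso (remove_isolated G) (complete_graph 2)"
  | (K3) "card (edges G) = 3" "Mad G = 2" "graph_iso (remove_isolated G) (complete_graph 3)"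
  | (P3) "card (edges G) = 2" "Mad G = 4 / 3" "graph_iso (remove_isolated G) (path_graph 3)"
  | (other) "Mad G < (real (card (edges G)) + 1) / 2 - 1 / 6"
proof -
  obtain H where H: "subgraph H G" "card (verts H) \<ge> 1"
    and Mad: "Mad G = 2 * real (card (edges H)) / real (card (verts H))"
    using Mad_attained[OF G] by blast
  define v h e where "v = card (verts H)" and "h = card (edges H)" and "e = card (edges G)"
  have HG: "edges H \<subseteq> edges G" "verts H \<subseteq> verts G" "finite_graph H"
    using H by (auto simp: subgraph_def)
  then have finH: "finite (verts H)" "edges H \<subseteq> nsets (verts H) 2" by (auto simp: finite_graph_def)
  have fin: "finite (edges G)" by (rule finite_graph_edges[OF G(1)])
  have he: "h \<le> e" unfolding h_def e_def using HG fin by (simp add: card_mono)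
  have hv: "h \<le> v choose 2" unfolding h_def v_def by (rule card_edges_le[OF HG(3)])
  have M: "Mad G = 2 * real h / real v" using Mad by (simp add: h_def v_def)
  \<comment> \<open>In the exceptional cases \<open>same\<close> puts all edges of \<open>G\<close>
    into \<open>H\<close>, and \<open>full\<close> recognises \<open>H\<close> as complete, so the
    graph without isolated vertices can be read off from \<open>H\<close>.\<close>
  have full: "edges H = nsets (verts H) 2" if "h = v choose 2"
    using that finH by (simp add: card_nsets card_subset_eq finite_imp_finite_nsets h_def v_def)
  have same: "edges H = edges G" if "h = e"
    using that HG fin by (simp add: card_subset_eq h_def e_def)
  have "v \<ge> 1" using H by (simp add: v_def)
  then consider "v = 1" | "v = 2" | "v = 3" | "v \<ge> 4" by linarith
  then show thesis
  proof cases
    case 1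
    then have "h = 0" using hv by (simp add: choose_two)
    then show thesis using M by (intro other) simp
  next
    case 2
    then have "h \<le> 1" using hv by (simp add: choose_two)
    show thesis
    proof (cases "h = 1 \<and> e = 1")
      case True
      then have "edges G = nsets (verts H) 2" using full same 2 by simp
      then have "remove_isolated G = Graph (verts H) (nsets (verts H) 2)"
        using HG finH 2 by (intro remove_isolated_complete) (auto simp: v_def)
      then show thesis
        using True M 2 finH graph_iso_complete[of "verts H" 2] by (intro K2) (auto simp: e_def v_def)
    next
      case False
      then have "2 * h < e + 1" using he \<open>h \<le> 1\<close> by linarith
      then have "real h \<le> real e / 2" by linarith
      then show thesis using M 2 by (intro other) (simp add: e_def[symmetric] field_simps)
    qed
  next
    case 3
    have "(3::nat) choose 2 = 3" by (simp add: choose_two)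
    then have "h \<le> 3" using hv 3 by simp
    \<comment> \<open>For \<open>v = 3\<close> the bound in \<open>other\<close> reads
      \<open>2 * h / 3 < e / 2 + 1 / 3\<close>, that is \<open>4 * h < 3 * e + 2\<close>. Given
      \<open>h \<le> e\<close> and \<open>h \<le> 3\<close>, it fails only for
      \<open>h = e = 2\<close>, with equality, and for \<open>h = e = 3\<close>.\<close>
    consider "h = 3" "e = 3" | "h = 2" "e = 2" | "4 * h < 3 * e + 2"
      using he \<open>h \<le> 3\<close> by linarith
    then show thesis
    proof cases
      case 1
      then have "edges G = nsets (verts H) 2" using full same 3 \<open>(3::nat) choose 2 = 3\<close> by simp
      then have "remove_isolated G = Graph (verts H) (nsets (verts H) 2)"
        using HG finH 3 by (intro remove_isolated_complete) (auto simp: v_def)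
      then show thesis
        using 1 M 3 finH graph_iso_complete[of "verts H" 3] by (intro K3) (auto simp: e_def v_def)
    next
      case 2
      obtain a b c where abc: "a \<noteq> b" "b \<noteq> c" "a \<noteq> c" "verts H = {a, b, c}" "edges H = {{a, b}, {b, c}}"
        using two_edges_three_vertices[of "verts H" "edges H"] 2 3 finH by (auto simp: h_def v_def)
      have E: "edges G = {{a, b}, {b, c}}" using same 2 abc by simp
      have "remove_isolated G = Graph {a, b, c} {{a, b}, {b, c}}"
        using HG(2) abc(4) by (auto simp: remove_isolated_def E)
      then show thesis
        using 2 M 3 graph_iso_path3[OF abc(1-3)] by (intro P3) (auto simp: e_def)
    next
      case 3
      then have "4 * real h < 3 * real e + 2" by linarith
      then show thesis using M \<open>v = 3\<close> by (intro other) (simp add: e_def[symmetric] field_simps)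
    qed
  next
    case 4
    have "Mad G \<le> real e / 2"
    proof -
      have "4 * h \<le> v * e" using 4 he by (simp add: mult_le_mono)
      then have "4 * real h \<le> real v * real e" by (metis of_nat_le_iff of_nat_mult of_nat_numeral)
      then show ?thesis using 4 unfolding M by (simp add: field_simps)
    qed
    then have "Mad G < (real e + 1) / 2 - 1 / 6" by (simp add: field_simps)
    then show thesis unfolding e_def by (rule other)
  qed
qed

section \<open>Edge partitions of complete graphs\<close>

lemma edge_partitionD:
  assumes "edge_partition k (complete_graph n) G" "i \<in> {1..k}"
  shows "finite_graph (G i)" "verts (G i) = {..<n}" "subgraph (G i) (complete_graph n)"
  using assms by (auto simp: edge_partition_def spanning_subgraph_def subgraph_def complete_graph_def)

lemma edge_partition_card:
  assumes "edge_partition k (complete_graph n) G"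
  shows "(\<Sum>i = 1..k. card (edges (G i))) = n choose 2"
proof -
  have "(\<Sum>i = 1..k. card (edges (G i))) = card (\<Union>i\<in>{1..k}. edges (G i))"
  proof (rule card_UN_disjoint[symmetric])
    show "\<forall>i\<in>{1..k}. finite (edges (G i))"
      using edge_partitionD(1)[OF assms] finite_graph_edges by blast
    show "\<forall>i\<in>{1..k}. \<forall>j\<in>{1..k}. i \<noteq> j \<longrightarrow> edges (G i) \<inter> edges (G j) = {}"
      using assms by (auto simp: edge_partition_def disjoint_family_on_def)
  qed simp
  also have "\<dots> = card (nsets {..<n} 2)"
    using assms by (simp add: edge_partition_def complete_graph_def)
  finally show ?thesis by (simp add: card_nsets)
qed

text \<open>The \<open>Max\<close> in \<open>M\<close> is over a finite set: a sum depends only on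
  the parts with index in \<open>{1..k}\<close>, each one of finitely many subgraphs, so the
  functions may be restricted to that interval.\<close>

lemma M_eqI:
  assumes le: "\<And>G. edge_partition k (complete_graph n) G \<Longrightarrow> (\<Sum>i = 1..k. Mad (G i)) \<le> c"
    and ex: "edge_partition k (complete_graph n) G" "c \<le> (\<Sum>i = 1..k. Mad (G i))"
  shows "M k n = c"
proof -
  let ?X = "{\<Sum>i = 1..k. Mad (G i) | G. edge_partition k (complete_graph n) G}"
  have "finite_graph (complete_graph n)" by (simp add: finite_graph_def complete_graph_def)
  then have fin: "finite (PiE {1..k} (\<lambda>_. {H. subgraph H (complete_graph n)}))"
    by (intro finite_PiE) (auto intro: subgraph_finite)
  have "?X \<subseteq> (\<lambda>G. \<Sum>i = 1..k. Mad (G i)) ` (PiE {1..k} (\<lambda>_. {H. subgraph H (complete_graph n)}))"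
  proof
    fix s assume "s \<in> ?X"
    then obtain G where G: "s = (\<Sum>i = 1..k. Mad (G i))" "edge_partition k (complete_graph n) G" by auto
    then have "restrict G {1..k} \<in> PiE {1..k} (\<lambda>_. {H. subgraph H (complete_graph n)})"
      using edge_partitionD(3) by auto
    moreover have "s = (\<Sum>i = 1..k. Mad (restrict G {1..k} i))" using G(1) by simp
    ultimately show "s \<in> (\<lambda>G. \<Sum>i = 1..k. Mad (G i)) ` (PiE {1..k} (\<lambda>_. {H. subgraph H (complete_graph n)}))"
      by blast
  qed
  then have "finite ?X" using fin by (meson finite_imageI finite_subset)
  moreover have "c \<in> ?X" using ex le[OF ex(1)] by force
  ultimately show ?thesis unfolding M_def using le by (intro Max_eqI) auto
qed

lemma rel_mset_parts:
  assumes "\<And>i. i \<in> {1..k} \<Longrightarrow> graph_iso (remove_isolated (G i)) (g i)"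
  shows "rel_mset graph_iso (parts_mset k G) (image_mset g (mset_set {1..k}))"
  unfolding parts_mset_def multiset.rel_map using assms
  by (intro multiset.rel_refl_strong) simp

lemma image_mset_const_on:
  assumes "finite A" "\<And>i. i \<in> A \<Longrightarrow> g i = c"
  shows "image_mset g (mset_set A) = replicate_mset (card A) c"
proof -
  have "image_mset g (mset_set A) = image_mset (\<lambda>_. c) (mset_set A)"
    using assms by (intro image_mset_cong) simp
  then show ?thesis by (simp add: image_mset_const_eq)
qed

section \<open>Upper bounds and the case of equality\<close>

text \<open>The reference value is affine in the number of edges, so its sum over a partition
  depends only on \<open>n\<close> and \<open>k\<close>, and maximising the sum of
  \<open>Mad\<close> means minimising the total defect.\<close>

definition Mad_defect :: "'a ugraph \<Rightarrow> real" where
  "Mad_defect G = (real (card (edges G)) + 1) / 2 - Mad G"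

lemma Mad_defect_cases:
  assumes "finite_graph G" "verts G \<noteq> {}"
  obtains (K2) "card (edges G) = 1" "Mad_defect G = 0" "graph_iso (remove_isolated G) (complete_graph 2)"
  | (K3) "card (edges G) = 3" "Mad_defect G = 0" "graph_iso (remove_isolated G) (complete_graph 3)"
  | (P3) "card (edges G) = 2" "Mad_defect G = 1 / 6" "graph_iso (remove_isolated G) (path_graph 3)"
  | (other) "Mad_defect G > 1 / 6"
  by (rule Mad_cases[OF assms]) (auto simp: Mad_defect_def field_simps)

text \<open>No defect lies strictly between 0 and \<open>1 / 6\<close>. The premise
  \<open>< 1 / 6\<close> serves twice: for parts of defect 0, and contrapositively for a part with
  an even number of edges.\<close>

lemma edge_partition_defect:
  assumes G: "edge_partition k (complete_graph n) G" and n: "n \<ge> 1" and i: "i \<in> {1..k}"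
  shows "Mad_defect (G i) \<ge> 0"
    and "Mad_defect (G i) < 1 / 6 \<Longrightarrow>
      card (edges (G i)) = 1 \<and> graph_iso (remove_isolated (G i)) (complete_graph 2) \<or>
      card (edges (G i)) = 3 \<and> graph_iso (remove_isolated (G i)) (complete_graph 3)"
    and "Mad_defect (G i) = 1 / 6 \<Longrightarrow>
      card (edges (G i)) = 2 \<and> graph_iso (remove_isolated (G i)) (path_graph 3)"
proof -
  have fg: "finite_graph (G i)" "verts (G i) \<noteq> {}"
    using edge_partitionD[OF G i] n by (auto simp: lessThan_empty_iff)
  show "Mad_defect (G i) \<ge> 0" by (rule Mad_defect_cases[OF fg]) auto
  show "card (edges (G i)) = 1 \<and> graph_iso (remove_isolated (G i)) (complete_graph 2) \<or>
      card (edges (G i)) = 3 \<and> graph_iso (remove_isolated (G i)) (complete_graph 3)"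
    if "Mad_defect (G i) < 1 / 6"
    by (rule Mad_defect_cases[OF fg]) (use that in auto)
  show "card (edges (G i)) = 2 \<and> graph_iso (remove_isolated (G i)) (path_graph 3)"
    if "Mad_defect (G i) = 1 / 6"
    by (rule Mad_defect_cases[OF fg]) (use that in auto)
qed

text \<open>The numbers of edges add up to \<open>n choose 2\<close>, so the reference values add up
  to half of \<open>(n choose 2) + k\<close>, and \<open>k\<close> differs from
  \<open>n choose 2\<close> by \<open>t\<close>.\<close>

lemma sum_Mad_eq:
  assumes G: "edge_partition k (complete_graph n) G" and k: "k + t = n choose 2"
  shows "(\<Sum>i = 1..k. Mad (G i)) = real (n choose 2) - real t / 2 - (\<Sum>i = 1..k. Mad_defect (G i))"
proof -
  have "(\<Sum>i = 1..k. Mad (G i)) + (\<Sum>i = 1..k. Mad_defect (G i)) =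
      (\<Sum>i = 1..k. (real (card (edges (G i))) + 1) / 2)"
    by (simp add: Mad_defect_def flip: sum.distrib)
  also have "\<dots> = ((\<Sum>i = 1..k. real (card (edges (G i)))) + real k) / 2"
    by (simp add: sum.distrib flip: sum_divide_distrib)
  also have "\<dots> = (real (n choose 2) + real k) / 2"
    using edge_partition_card[OF G] by (metis of_nat_sum)
  also have "\<dots> = real (n choose 2) - real t / 2" using k by (simp add: field_simps flip: of_nat_add)
  finally show ?thesis by simp
qed

text \<open>Defects are nonnegative, and equality makes all of them 0, so every part is a single
  edge or a triangle. Counting parts and edges then gives \<open>t = 2 * card A\<close>, which fixes
  both multiplicities.\<close>

lemma sum_Mad_le_even:
  assumes G: "edge_partition k (complete_graph n) G" and n: "n \<ge> 1" and k: "k + t = n choose 2"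
  shows "(\<Sum>i = 1..k. Mad (G i)) \<le> real (n choose 2) - real t / 2"
    and "(\<Sum>i = 1..k. Mad (G i)) = real (n choose 2) - real t / 2 \<Longrightarrow>
      rel_mset graph_iso (parts_mset k G)
        (replicate_mset (t div 2) (complete_graph 3) +
         replicate_mset ((n choose 2) - 3 * t div 2) (complete_graph 2))"
proof -
  define d where "d = (\<lambda>i. Mad_defect (G i))"
  note L = sum_Mad_eq[OF G k] edge_partition_defect[OF G n]
  note L = L[folded d_def[THEN fun_cong]]
  show "(\<Sum>i = 1..k. Mad (G i)) \<le> real (n choose 2) - real t / 2"
    using L(1) sum_nonneg[of "{1..k}" d, OF L(2)] by simp
  assume "(\<Sum>i = 1..k. Mad (G i)) = real (n choose 2) - real t / 2"
  then have "(\<Sum>i = 1..k. d i) = 0" using L(1) by simp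
  then have "\<forall>i\<in>{1..k}. d i = 0"
    by (subst (asm) sum_nonneg_eq_0_iff) (use L(2) in auto)
  then have i: "card (edges (G i)) = 1 \<and> graph_iso (remove_isolated (G i)) (complete_graph 2) \<or>
       card (edges (G i)) = 3 \<and> graph_iso (remove_isolated (G i)) (complete_graph 3)" if "i \<in> {1..k}" for i
    using L(3)[of i] that by auto
  define A B where "A = {i \<in> {1..k}. card (edges (G i)) = 3}"
    and "B = {i \<in> {1..k}. card (edges (G i)) = 1}"
  have "j \<in> A \<union> B" if "j \<in> {1..k}" for j using i[OF that] that by (auto simp: A_def B_def)
  then have "{1..k} \<subseteq> A \<union> B" by blast
  moreover have "A \<subseteq> {1..k}" "B \<subseteq> {1..k}" by (auto simp: A_def B_def)
  ultimately have AB: "{1..k} = A \<union> B" by blast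
  have AB: "{1..k} = A \<union> B" "A \<inter> B = {}" "finite A" "finite B" by (fact AB) (auto simp: A_def B_def)
  have "card {1..k} = card A + card B" unfolding AB(1) using AB by (intro card_Un_disjoint)
  then have c1: "k = card A + card B" by simp
  have "(\<Sum>i = 1..k. card (edges (G i))) = (\<Sum>i\<in>A. card (edges (G i))) + (\<Sum>i\<in>B. card (edges (G i)))"
    unfolding AB(1) using AB by (intro sum.union_disjoint)
  also have "\<dots> = 3 * card A + card B" by (simp add: A_def B_def)
  finally have c2: "n choose 2 = 3 * card A + card B" using edge_partition_card[OF G] by simp
  have c: "card A = t div 2" "card B = (n choose 2) - 3 * t div 2" using c1 c2 k by linarith+
  define g where "g = (\<lambda>i. if i \<in> A then complete_graph 3 else complete_graph 2)"
  have "rel_mset graph_iso (parts_mset k G) (image_mset g (mset_set {1..k}))"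
  proof (rule rel_mset_parts)
    fix j assume j: "j \<in> {1..k}"
    show "graph_iso (remove_isolated (G j)) (g j)" using i[OF j] j by (auto simp: g_def A_def)
  qed
  also have "image_mset g (mset_set {1..k}) = image_mset g (mset_set A) + image_mset g (mset_set B)"
    unfolding AB(1) using AB by (simp add: mset_set_Union)
  also have "image_mset g (mset_set A) = replicate_mset (t div 2) (complete_graph 3)"
    using image_mset_const_on[OF AB(3), of g] by (simp add: g_def c)
  also have "image_mset g (mset_set B) = replicate_mset ((n choose 2) - 3 * t div 2) (complete_graph 2)"
    unfolding c(2)[symmetric] using AB by (intro image_mset_const_on) (auto simp: g_def)
  finally show "rel_mset graph_iso (parts_mset k G)
        (replicate_mset (t div 2) (complete_graph 3) +
         replicate_mset ((n choose 2) - 3 * t div 2) (complete_graph 2))" .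
qed

text \<open>If all parts had an odd number of edges, \<open>n choose 2\<close> would have the parity
  of \<open>k\<close>, against \<open>odd t\<close>. So some part \<open>p\<close> has an even
  number of edges and defect at least \<open>1 / 6\<close>; equality makes \<open>p\<close> a path
  and all other defects 0.\<close>

lemma sum_Mad_le_odd:
  assumes G: "edge_partition k (complete_graph n) G" and n: "n \<ge> 1" and k: "k + t = n choose 2"
    and t: "odd t"
  shows "(\<Sum>i = 1..k. Mad (G i)) \<le> real (n choose 2) - real t / 2 - 1 / 6"
    and "(\<Sum>i = 1..k. Mad (G i)) = real (n choose 2) - real t / 2 - 1 / 6 \<Longrightarrow>
      rel_mset graph_iso (parts_mset k G)
        (replicate_mset ((t - 1) div 2) (complete_graph 3) +
         replicate_mset ((n choose 2) - 2 - 3 * (t - 1) div 2) (complete_graph 2) +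
         replicate_mset 1 (path_graph 3))"
proof -
  define d where "d = (\<lambda>i. Mad_defect (G i))"
  note L = sum_Mad_eq[OF G k] edge_partition_defect[OF G n]
  note L = L[folded d_def[THEN fun_cong]]
  obtain p where p: "p \<in> {1..k}" "even (card (edges (G p)))"
  proof (rule ccontr)
    assume "\<not> thesis"
    then have "\<forall>i\<in>{1..k}. odd (card (edges (G i)))" using that by blast
    then have "{i \<in> {1..k}. odd (card (edges (G i)))} = {1..k}" by blast
    then have "even (\<Sum>i = 1..k. card (edges (G i))) \<longleftrightarrow> even k"
      by (simp add: even_sum_iff)
    then show False using edge_partition_card[OF G] k t by (metis even_add)
  qed
  have dp: "d p \<ge> 1 / 6" using L(3)[OF p(1)] p(2) by force
  have sum: "(\<Sum>i = 1..k. d i) = d p + (\<Sum>i\<in>{1..k} - {p}. d i)"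
    using p by (intro sum.remove) auto
  have nn: "(\<Sum>i\<in>{1..k} - {p}. d i) \<ge> 0" using L(2) by (intro sum_nonneg) auto
  show "(\<Sum>i = 1..k. Mad (G i)) \<le> real (n choose 2) - real t / 2 - 1 / 6"
    using L(1) sum nn dp by linarith
  assume "(\<Sum>i = 1..k. Mad (G i)) = real (n choose 2) - real t / 2 - 1 / 6"
  then have "(\<Sum>i = 1..k. d i) = 1 / 6" using L(1) by simp
  then have dp6: "d p = 1 / 6" and "(\<Sum>i\<in>{1..k} - {p}. d i) = 0" using sum nn dp by linarith+
  then have "\<forall>i\<in>{1..k} - {p}. d i = 0"
    by (subst (asm) sum_nonneg_eq_0_iff) (use L(2) in auto)
  then have i: "card (edges (G i)) = 1 \<and> graph_iso (remove_isolated (G i)) (complete_graph 2) \<or>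
       card (edges (G i)) = 3 \<and> graph_iso (remove_isolated (G i)) (complete_graph 3)"
    if "i \<in> {1..k}" "i \<noteq> p" for i
    using L(3)[of i] that by auto
  have ip: "card (edges (G p)) = 2" "graph_iso (remove_isolated (G p)) (path_graph 3)"
    using L(4)[OF p(1) dp6] by auto
  define A B where "A = {i \<in> {1..k}. card (edges (G i)) = 3}"
    and "B = {i \<in> {1..k}. card (edges (G i)) = 1}"
  have "j \<in> A \<union> B \<union> {p}" if "j \<in> {1..k}" for j
    using i[OF that] that by (cases "j = p") (auto simp: A_def B_def)
  then have "{1..k} \<subseteq> A \<union> B \<union> {p}" by blast
  moreover have "A \<subseteq> {1..k}" "B \<subseteq> {1..k}" "{p} \<subseteq> {1..k}" using p(1) by (auto simp: A_def B_def)
  ultimately have AB: "{1..k} = A \<union> B \<union> {p}" by blast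
  have AB: "{1..k} = A \<union> B \<union> {p}" "A \<inter> B = {}" "(A \<union> B) \<inter> {p} = {}" "finite A" "finite B"
    by (fact AB) (use ip(1) in \<open>auto simp: A_def B_def\<close>)
  have "card {1..k} = card A + card B + 1" unfolding AB(1) using AB(2-) by (simp add: card_Un_disjoint)
  then have c1: "k = card A + card B + 1" by simp
  have "(\<Sum>i = 1..k. card (edges (G i))) =
      (\<Sum>i\<in>A. card (edges (G i))) + (\<Sum>i\<in>B. card (edges (G i))) + card (edges (G p))"
    unfolding AB(1) using AB(2-) by (simp add: sum.union_disjoint)
  also have "\<dots> = 3 * card A + card B + 2" by (simp add: A_def B_def ip)
  finally have c2: "n choose 2 = 3 * card A + card B + 2" using edge_partition_card[OF G] by simp
  have "t = 2 * card A + 1" using c1 c2 k by linarith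
  then have c: "card A = (t - 1) div 2" "card B = (n choose 2) - 2 - 3 * (t - 1) div 2"
    using c2 by simp_all
  define g where "g = (\<lambda>i. if i = p then path_graph 3 else if i \<in> A then complete_graph 3 else complete_graph 2)"
  have "rel_mset graph_iso (parts_mset k G) (image_mset g (mset_set {1..k}))"
  proof (rule rel_mset_parts)
    fix j assume j: "j \<in> {1..k}"
    show "graph_iso (remove_isolated (G j)) (g j)"
      using i[OF j] ip j by (cases "j = p") (auto simp: g_def A_def)
  qed
  also have "image_mset g (mset_set {1..k}) =
      image_mset g (mset_set A) + image_mset g (mset_set B) + image_mset g (mset_set {p})"
    unfolding AB(1) using AB(2-) by (simp add: mset_set_Union)
  also have "image_mset g (mset_set A) = replicate_mset ((t - 1) div 2) (complete_graph 3)"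
    unfolding c(1)[symmetric] using AB by (intro image_mset_const_on) (auto simp: g_def)
  also have "image_mset g (mset_set B) = replicate_mset ((n choose 2) - 2 - 3 * (t - 1) div 2) (complete_graph 2)"
    unfolding c(2)[symmetric] using AB by (intro image_mset_const_on) (auto simp: g_def)
  also have "image_mset g (mset_set {p}) = replicate_mset 1 (path_graph 3)" by (simp add: g_def)
  finally show "rel_mset graph_iso (parts_mset k G)
        (replicate_mset ((t - 1) div 2) (complete_graph 3) +
         replicate_mset ((n choose 2) - 2 - 3 * (t - 1) div 2) (complete_graph 2) +
         replicate_mset 1 (path_graph 3))" .
qed

section \<open>Partitions attaining the bounds\<close>

text \<open>Parts are spanning, so isolated vertices dilute their average degree; the subgraph
  \<open>Graph W E\<close> discards them. It is applied to single edges, triangles and pairs of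
  adjacent edges.\<close>

lemma Mad_ge_clique:
  assumes "finite V" "W \<subseteq> V" "W \<noteq> {}" "E \<subseteq> nsets W 2"
  shows "2 * real (card E) / real (card W) \<le> Mad (Graph V E)"
proof -
  have W: "finite W" using assms finite_subset by blast
  have "E \<subseteq> nsets V 2" using assms nsets_mono by blast
  then have "2 * real (card (edges (Graph W E))) / real (card (verts (Graph W E))) \<le> Mad (Graph V E)"
    using assms W by (intro Mad_ge) (auto simp: finite_graph_def subgraph_def Suc_le_eq card_gt_0_iff)
  then show ?thesis by simp
qed

lemma partition_on_Un:
  assumes "partition_on A P" "partition_on B Q" "A \<inter> B = {}"
  shows "partition_on (A \<union> B) (P \<union> Q)"
  using assms disjoint_union[of P Q] unfolding partition_on_def by simp

text \<open>Each edge outside \<open>C\<close> becomes a part of its own, with \<open>Mad\<close> at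
  least 1; the equation for \<open>k\<close> says that these and the members of \<open>P\<close> are
  \<open>k\<close> parts in total.\<close>

lemma edge_partition_of_partial:
  assumes P: "partition_on C P" and C: "C \<subseteq> nsets {..<n} 2"
    and k: "k + card C = card P + (n choose 2)"
  shows "\<exists>G. edge_partition k (complete_graph n) G \<and>
    (\<Sum>p\<in>P. Mad (Graph {..<n} p)) + (real (n choose 2) - real (card C)) \<le> (\<Sum>i = 1..k. Mad (G i))"
proof -
  let ?E = "nsets {..<n} (2::nat)"
  define S where "S = (\<lambda>e. {e}) ` (?E - C)"
  have finE: "finite ?E" by (simp add: finite_imp_finite_nsets)
  have finC: "finite C" using C finE finite_subset by blast
  have finP: "finite P" using P finC by (simp add: finite_elements)
  have "partition_on (C \<union> (?E - C)) (P \<union> S)"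
    unfolding S_def by (intro partition_on_Un P partition_on_singletons) auto
  then have part: "partition_on ?E (P \<union> S)" using C by (simp add: Un_absorb1)
  have PS: "P \<inter> S = {}"
  proof -
    have "s \<notin> P" if "s \<in> S" for s
    proof
      assume "s \<in> P"
      then have "s \<subseteq> C" using P by (auto simp: partition_on_def)
      then show False using that by (auto simp: S_def)
    qed
    then show ?thesis by blast
  qed
  have finS: "finite S" using finE by (simp add: S_def)
  have cS: "card S + card C = n choose 2"
  proof -
    have "card S = card (?E - C)" unfolding S_def by (intro card_image) auto
    also have "\<dots> = card ?E - card C" using C finC by (rule card_Diff_subset[rotated])
    finally show ?thesis using card_mono[OF finE C] by (simp add: card_nsets)
  qed
  have "card (P \<union> S) = k" using card_Un_disjoint[OF finP finS PS] cS k by linarith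
  then obtain h where h: "bij_betw h {1..k} (P \<union> S)"
    using ex_bij_betw_nat_finite_1[of "P \<union> S"] finP finS by auto
  define G where "G = (\<lambda>i. Graph {..<n} (h i))"
  have hin: "h i \<in> P \<union> S" if "i \<in> {1..k}" for i using h that by (auto simp: bij_betw_def)
  have hun: "(\<Union>i\<in>{1..k}. h i) = ?E"
    using h part by (simp add: bij_betw_def partition_on_def)
  have "edge_partition k (complete_graph n) G"
    unfolding edge_partition_def
  proof (intro conjI ballI)
    fix i assume "i \<in> {1..k}"
    then have "h i \<subseteq> ?E" using hun by blast
    then show "spanning_subgraph (G i) (complete_graph n)"
      by (simp add: spanning_subgraph_def subgraph_def G_def complete_graph_def finite_graph_def)
  next
    show "disjoint_family_on (\<lambda>i. edges (G i)) {1..k}"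
      unfolding disjoint_family_on_def
    proof (intro ballI impI)
      fix i j assume ij: "i \<in> {1..k}" "j \<in> {1..k}" "i \<noteq> j"
      then have "h i \<noteq> h j" using bij_betw_imp_inj_on[OF h] by (meson inj_onD)
      then show "edges (G i) \<inter> edges (G j) = {}"
        using disjointD[OF partition_onD2[OF part] hin[OF ij(1)] hin[OF ij(2)]] by (simp add: G_def)
    qed
    show "(\<Union>i\<in>{1..k}. edges (G i)) = edges (complete_graph n)"
      using hun by (simp add: G_def complete_graph_def)
  qed
  moreover have "(\<Sum>i = 1..k. Mad (G i)) = (\<Sum>p\<in>P \<union> S. Mad (Graph {..<n} p))"
    unfolding G_def using sum.reindex_bij_betw[OF h, of "\<lambda>p. Mad (Graph {..<n} p)"] .
  moreover have "\<dots> = (\<Sum>p\<in>P. Mad (Graph {..<n} p)) + (\<Sum>p\<in>S. Mad (Graph {..<n} p))"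
    using finP finS PS by (rule sum.union_disjoint)
  moreover have "real (card S) \<le> (\<Sum>p\<in>S. Mad (Graph {..<n} p))"
  proof -
    have "1 \<le> Mad (Graph {..<n} s)" if "s \<in> S" for s
    proof -
      obtain e where e: "s = {e}" "e \<in> ?E" using \<open>s \<in> S\<close> by (auto simp: S_def)
      then have "e \<subseteq> {..<n}" "finite e" "card e = 2" "e \<noteq> {}" by (auto simp: nsets_def)
      then show ?thesis using Mad_ge_clique[of "{..<n}" e "{e}"] by (simp add: nsets_def e(1))
    qed
    then show ?thesis using sum_bounded_below[of S 1 "\<lambda>p. Mad (Graph {..<n} p)"] by simp
  qed
  moreover have "real (n choose 2) - real (card C) = real (card S)" using cS by linarith
  ultimately show ?thesis by (intro exI[of _ G]) simp
qed

text \<open>Distinct triples share at most one point, so their edge sets are disjoint. A triangle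
  has three edges on three vertices, hence \<open>Mad\<close> at least 2.\<close>

lemma triangles_partition:
  fixes n :: nat
  assumes T: "triple_packing {..<n} T"
  defines "P \<equiv> (\<lambda>A. nsets A 2) ` T"
  shows "partition_on (\<Union>P) P" "\<Union>P \<subseteq> nsets {..<n} 2" "card P = card T" "card (\<Union>P) = 3 * card T"
    "2 * real (card T) \<le> (\<Sum>p\<in>P. Mad (Graph {..<n} p))"
proof -
  have finT: "finite T" using triple_packing_finite[OF T] by simp
  have A: "A \<subseteq> {..<n}" "card A = 3" "finite A" if "A \<in> T" for A
    using triple_packingD(1,2)[OF T that] by (auto intro: finite_subset)
  have c3: "card (nsets A 2) = 3" if "A \<in> T" for A
    using A[OF that] by (simp add: card_nsets choose_two)
  have disj: "nsets A 2 \<inter> nsets B 2 = {}" if "A \<in> T" "B \<in> T" "A \<noteq> B" for A B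
  proof (rule ccontr)
    assume "nsets A 2 \<inter> nsets B 2 \<noteq> {}"
    then obtain e where "e \<subseteq> A" "e \<subseteq> B" "card e = 2" by (auto simp: nsets_def)
    then obtain u v where "u \<noteq> v" "u \<in> A" "v \<in> A" "u \<in> B" "v \<in> B" by (auto simp: card_2_iff)
    then show False using triple_packingD(3)[OF T] that by blast
  qed
  have ne: "nsets A 2 \<noteq> {}" if "A \<in> T" for A using c3[OF that] by force
  have inj: "inj_on (\<lambda>A. nsets A (2::nat)) T"
    using disj ne by (metis (no_types, lifting) inf.idem inj_onI)
  show "partition_on (\<Union>P) P"
  proof (rule partition_onI)
    show "disjnt p r" if "p \<in> P" "r \<in> P" "p \<noteq> r" for p r
      using that disj unfolding P_def disjnt_def by blast
    show "{} \<notin> P" using ne unfolding P_def by blast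
  qed simp
  show "\<Union>P \<subseteq> nsets {..<n} 2" using A(1) nsets_mono by (fastforce simp: P_def)
  show cP: "card P = card T" unfolding P_def using inj by (rule card_image)
  have "card (\<Union>P) = (\<Sum>A\<in>T. card (nsets A 2))"
    unfolding P_def using finT disj A by (intro card_UN_disjoint) (auto simp: finite_imp_finite_nsets)
  also have "\<dots> = (\<Sum>A\<in>T. 3)" by (rule sum.cong[OF refl c3])
  finally show "card (\<Union>P) = 3 * card T" by simp
  have "2 \<le> Mad (Graph {..<n} (nsets A 2))" if "A \<in> T" for A
  proof -
    have "A \<noteq> {}" using A(2)[OF that] by auto
    then show ?thesis
      using Mad_ge_clique[of "{..<n}" A "nsets A 2"] A[OF that] c3[OF that] by auto
  qed
  then have "2 \<le> Mad (Graph {..<n} p)" if "p \<in> P" for p using that by (auto simp: P_def)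
  then show "2 * real (card T) \<le> (\<Sum>p\<in>P. Mad (Graph {..<n} p))"
    using sum_bounded_below[of P 2 "\<lambda>p. Mad (Graph {..<n} p)"] cP by simp
qed

text \<open>A matching on \<open>n\<close> vertices has at most \<open>n / 2\<close> edges.\<close>

lemma ex_adjacent_edges:
  assumes "F \<subseteq> nsets {..<n} 2" "2 * card F > n"
  obtains e f where "e \<in> F" "f \<in> F" "e \<noteq> f" "e \<inter> f \<noteq> {}"
proof (rule ccontr)
  assume "\<not> thesis"
  then have "\<forall>e\<in>F. \<forall>f\<in>F. e \<noteq> f \<longrightarrow> e \<inter> f = {}" using that by blast
  moreover have "finite F" using assms(1) by (meson finite_imp_finite_nsets finite_lessThan finite_subset)
  moreover have F: "finite e" "card e = 2" "e \<subseteq> {..<n}" if "e \<in> F" for e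
    using assms(1) that by (auto simp: nsets_def)
  ultimately have "card (\<Union>e\<in>F. e) = (\<Sum>e\<in>F. card e)"
    by (intro card_UN_disjoint) auto
  also have "\<dots> = 2 * card F" by (simp add: F)
  finally have "2 * card F \<le> card {..<n}"
    using F(3) by (metis UN_least card_mono finite_lessThan)
  then show False using assms(2) by simp
qed

text \<open>The \<open>b\<close> triangles contribute 2 each and all other edges 1 each, in total at
  least \<open>2 * b + ((n choose 2) - 3 * b)\<close>.\<close>

lemma ex_edge_partition_even:
  assumes n: "n \<ge> 1" and b: "6 * b \<le> (n - 1)\<^sup>2" and k: "k + 2 * b = n choose 2"
  shows "\<exists>G. edge_partition k (complete_graph n) G \<and> real (n choose 2) - real b \<le> (\<Sum>i = 1..k. Mad (G i))"
proof -
  obtain T where T: "triple_packing {..<n} T" "card T = b"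
    using ex_triple_packing[OF n b] by blast
  note P = triangles_partition[OF T(1)]
  have "k + card (\<Union>((\<lambda>A. nsets A 2) ` T)) = card ((\<lambda>A. nsets A 2) ` T) + (n choose 2)"
    unfolding P(3,4) using k T(2) by simp
  from edge_partition_of_partial[OF P(1,2) this] P(4,5) T(2) show ?thesis by fastforce
qed

text \<open>With \<open>b\<close> triangles, one pair of adjacent edges and otherwise single edges,
  the sum is at least \<open>2 * b + 4 / 3 + ((n choose 2) - 3 * b - 2)\<close>.\<close>

lemma ex_edge_partition_odd:
  assumes n: "n \<ge> 1" and b: "6 * b + 3 \<le> (n - 1)\<^sup>2" and k: "k + 2 * b + 1 = n choose 2"
  shows "\<exists>G. edge_partition k (complete_graph n) G \<and>
    real (n choose 2) - real b - 2 / 3 \<le> (\<Sum>i = 1..k. Mad (G i))"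
proof -
  obtain T where T: "triple_packing {..<n} T" "card T = b"
    using ex_triple_packing[OF n, of b] b by auto
  define P where "P = (\<lambda>A. nsets A (2::nat)) ` T"
  define F where "F = nsets {..<n} (2::nat) - \<Union>P"
  note P = triangles_partition[OF T(1), folded P_def]
  have fin: "finite (nsets {..<n} (2::nat))" by (simp add: finite_imp_finite_nsets)
  have finU: "finite (\<Union>P)" using P(2) fin finite_subset by blast
  have cF: "card F + 3 * b = n choose 2"
    using card_Diff_subset[OF finU P(2)] card_mono[OF fin P(2)] P(4) T(2) by (simp add: F_def card_nsets)
  have "even (n * (n - 1))" using n by (cases n) auto
  then have "2 * (n choose 2) = n * (n - 1)" by (simp add: choose_two)
  moreover have "n * (n - 1) = (n - 1)\<^sup>2 + (n - 1)"
    using n by (cases n) (auto simp: power2_eq_square)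
  \<comment> \<open>Twice the number of uncovered edges is \<open>n * (n - 1) - 6 * b\<close>, and
    the assumption on \<open>b\<close> makes this at least \<open>(n - 1) + 3\<close>.\<close>
  ultimately have "2 * card F > n" using cF b n by linarith
  moreover have "F \<subseteq> nsets {..<n} 2" by (simp add: F_def)
  ultimately obtain e f where ef: "e \<in> F" "f \<in> F" "e \<noteq> f" "e \<inter> f \<noteq> {}"
    using ex_adjacent_edges by metis
  have e: "e \<subseteq> {..<n}" "f \<subseteq> {..<n}" "finite e" "finite f" "card e = 2" "card f = 2"
    using ef by (auto simp: F_def nsets_def)
  have c: "card (e \<union> f) \<le> 3"
  proof -
    have "card (e \<inter> f) \<noteq> 0" using ef e by simp
    then show ?thesis using card_Un_Int[OF e(3,4)] e by linarith
  qed
  have pos: "0 < card (e \<union> f)" using e by (auto simp: card_gt_0_iff)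
  have "2 * real (card {e, f}) / real (card (e \<union> f)) \<le> Mad (Graph {..<n} {e, f})"
    using e by (intro Mad_ge_clique) (auto simp: nsets_def)
  moreover have "4 / 3 \<le> 2 * real (card {e, f}) / real (card (e \<union> f))"
    using c pos ef(3) by (simp add: field_simps)
  ultimately have Mq: "4 / 3 \<le> Mad (Graph {..<n} {e, f})" by linarith
  have efU: "\<Union>P \<inter> {e, f} = {}" using ef by (auto simp: F_def)
  have part: "partition_on (\<Union>P \<union> {e, f}) (P \<union> {{e, f}})"
    using P(1) efU by (intro partition_on_Un partition_on_space) auto
  have sub: "\<Union>P \<union> {e, f} \<subseteq> nsets {..<n} 2" using P(2) ef by (auto simp: F_def)
  have nP: "{e, f} \<notin> P" using efU by auto
  have finP: "finite P" using P(1) finU by (simp add: finite_elements)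
  have cU: "card (\<Union>P \<union> {e, f}) = 3 * b + 2"
    using card_Un_disjoint[OF finU _ efU] P(4) T(2) ef(3) by simp
  have cP: "card (P \<union> {{e, f}}) = b + 1" using nP finP P(3) T(2) by simp
  have "k + card (\<Union>P \<union> {e, f}) = card (P \<union> {{e, f}}) + (n choose 2)"
    unfolding cU cP using k by simp
  from edge_partition_of_partial[OF part sub this] obtain G where
    G: "edge_partition k (complete_graph n) G"
    "(\<Sum>p\<in>P \<union> {{e, f}}. Mad (Graph {..<n} p)) + (real (n choose 2) - real (card (\<Union>P \<union> {e, f})))
      \<le> (\<Sum>i = 1..k. Mad (G i))" by blast
  have "(\<Sum>p\<in>P \<union> {{e, f}}. Mad (Graph {..<n} p)) =
      Mad (Graph {..<n} {e, f}) + (\<Sum>p\<in>P. Mad (Graph {..<n} p))"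
    using nP finP by simp
  then have "real (n choose 2) - real b - 2 / 3 \<le> (\<Sum>i = 1..k. Mad (G i))"
    using G(2) P(5) T(2) Mq unfolding cU by simp
  with G(1) show ?thesis by blast
qed

lemma M_and_extremal_multisetI:
  assumes le: "\<And>G. edge_partition k (complete_graph n) G \<Longrightarrow> (\<Sum>i = 1..k. Mad (G i)) \<le> c"
    and uniq: "\<And>G. edge_partition k (complete_graph n) G \<Longrightarrow> (\<Sum>i = 1..k. Mad (G i)) = c \<Longrightarrow>
        rel_mset graph_iso (parts_mset k G) X"
    and ex: "\<exists>G. edge_partition k (complete_graph n) G \<and> c \<le> (\<Sum>i = 1..k. Mad (G i))"
  shows "M k n = c \<and> the_extremal_multiset k n X"
proof -
  obtain G where G: "edge_partition k (complete_graph n) G" "c \<le> (\<Sum>i = 1..k. Mad (G i))"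
    using ex by blast
  have Mc: "M k n = c" using le G by (rule M_eqI)
  then have "extremal_partition k n G" using G le[OF G(1)] by (simp add: extremal_partition_def)
  moreover have "rel_mset graph_iso (parts_mset k G') X" if "extremal_partition k n G'" for G'
    using that Mc uniq by (simp add: extremal_partition_def)
  ultimately show ?thesis unfolding the_extremal_multiset_def using Mc by blast
qed

theorem theorem5p4:
  fixes n k t :: nat
  assumes "n \<ge> 3"
    and "real k = real (n choose 2) - real t"
    and "real t \<le> 1 / 3 * (real n - 1) ^ 2"
  shows "(even t \<longrightarrow>
            M k n = real (n choose 2) - 1 / 2 * real t \<and>
            the_extremal_multiset k n
              (replicate_mset (t div 2) (complete_graph 3) +
               replicate_mset ((n choose 2) - 3 * t div 2) (complete_graph 2))) \<and>
         (odd t \<longrightarrow>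
            M k n = real (n choose 2) - 1 / 2 * (real t + 1) + 1 / 3 \<and>
            the_extremal_multiset k n
              (replicate_mset ((t - 1) div 2) (complete_graph 3) +
               replicate_mset ((n choose 2) - 2 - 3 * (t - 1) div 2) (complete_graph 2) +
               replicate_mset 1 (path_graph 3)))"
proof -
  have n: "n \<ge> 1" using assms(1) by simp
  have k: "k + t = n choose 2" using assms(2) by linarith
  \<comment> \<open>Over the naturals the bound on \<open>t\<close> becomes
    \<open>6 * b \<le> (n - 1)\<^sup>2\<close> for \<open>t = 2 * b\<close> and
    \<open>6 * b + 3 \<le> (n - 1)\<^sup>2\<close> for \<open>t = 2 * b + 1\<close>, the premises of
    the two existence lemmas.\<close>
  have "real (3 * t) \<le> real ((n - 1)\<^sup>2)" using assms(3) n by (simp add: of_nat_diff)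
  then have t: "3 * t \<le> (n - 1)\<^sup>2" by (rule of_nat_le_iff[THEN iffD1])
  show ?thesis
  proof (intro conjI[of "even t \<longrightarrow> _"] impI)
    assume "even t"
    then obtain b where b: "t = 2 * b" by (rule evenE)
    show "M k n = real (n choose 2) - 1 / 2 * real t \<and>
            the_extremal_multiset k n
              (replicate_mset (t div 2) (complete_graph 3) +
               replicate_mset ((n choose 2) - 3 * t div 2) (complete_graph 2))"
    proof (rule M_and_extremal_multisetI)
      show "\<exists>G. edge_partition k (complete_graph n) G \<and>
          real (n choose 2) - 1 / 2 * real t \<le> (\<Sum>i = 1..k. Mad (G i))"
        using ex_edge_partition_even[OF n, of b k] t k by (simp add: b)
    qed (use sum_Mad_le_even[OF _ n k] in simp_all)
  next
    assume o: "odd t"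
    then obtain b where b: "t = 2 * b + 1" by (rule oddE)
    have c: "real (n choose 2) - 1 / 2 * (real t + 1) + 1 / 3 = real (n choose 2) - real t / 2 - 1 / 6"
      by (simp add: field_simps)
    show "M k n = real (n choose 2) - 1 / 2 * (real t + 1) + 1 / 3 \<and>
            the_extremal_multiset k n
              (replicate_mset ((t - 1) div 2) (complete_graph 3) +
               replicate_mset ((n choose 2) - 2 - 3 * (t - 1) div 2) (complete_graph 2) +
               replicate_mset 1 (path_graph 3))"
      unfolding c
    proof (rule M_and_extremal_multisetI)
      have c': "real (n choose 2) - real t / 2 - 1 / 6 = real (n choose 2) - real b - 2 / 3"
        by (simp add: b field_simps)
      show "\<exists>G. edge_partition k (complete_graph n) G \<and>
          real (n choose 2) - real t / 2 - 1 / 6 \<le> (\<Sum>i = 1..k. Mad (G i))"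
        unfolding c' using t k by (intro ex_edge_partition_odd n) (simp_all add: b)
    qed (fact sum_Mad_le_odd[OF _ n k o])+
  qed
qed

end
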